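(* Let $\mathscr{M}_n$ be the rewriting 2-theory of $n$-fold monoidal categories. If $a$ and $b$ are terms of $\mathbb{F}(\mathscr{M}_n)$ having no repeated variables, then there is at most one reduction $a\to b$ in $\mathbb{F}(\mathscr{M}_n)$.
   Context: All compositions are written in diagrammatic order ($f\cdot g$ is $f$ followed by $g$). **Rewriting 2-theories.** $X$ is a fixed countably infinite set of variables. For a graded set $\mathcal{F}$ of function symbols, $\mathbb{F}_{\mathcal{F}}(X)$ is the absolutely free term algebra. For a set $\mathcal{E}_{\mathcal{F}}$ of equations between terms, $[t]$ is the class of $t$ modulo the equational theory generated by $\mathcal{E}_{\mathcal{F}}$. Given also a set $\mathcal{T}$ of labelled reduction rules $\tau:[s]\to[t]$ (each label has a unique source and target), reductions are generated inductively by: identities $1_s:[s]\to[s]$ (also written $id_s$); $F(\varphi_1,\dots,\varphi_m):[F(s_1,\dots,s_m)]\to[F(t_1,\dots,t_m)]$ for an $m$-ary $F\in\mathcal{F}$ and reductions $\varphi_i:[s_i]\to[t_i]$; $\tau(\varphi_1,\dots,\varphi_m):[s(s_1,\dots,s_m)]\to[t(t_1,\dots,t_m)]$ for a rule $\tau:[s(x_1,\dots,x_m)]\to[t(x_1,\dots,x_m)]$; and composites $\varphi\cdot\psi$. A rewriting 2-theory $\mathcal{R}=\langle\mathcal{F};\mathcal{T}\mid\mathcal{E}_{\mathcal{F}};\mathcal{E}_{\mathcal{T}}\rangle$ has in addition a set $\mathcal{E}_{\mathcal{T}}$ of equations between parallel reductions, together with the standard congruence: identities are units for $\cdot$; $\cdot$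 is associative; $F(\varphi_1,\dots,\varphi_m)\cdot F(\psi_1,\dots,\psi_m)=F(\varphi_1\cdot\psi_1,\dots,\varphi_m\cdot\psi_m)$; and for $\varphi:[s]\to[t]$, $\varphi_i:[s_i]\to[t_i]$: $\varphi(\varphi_1,\dots,\varphi_m)=s(\varphi_1,\dots,\varphi_m)\cdot\varphi(1_{t_1},\dots,1_{t_m})=\varphi(1_{s_1},\dots,1_{s_m})\cdot t(\varphi_1,\dots,\varphi_m)$. $\mathbb{F}(\mathcal{R})$ denotes terms (modulo $\mathcal{E}_{\mathcal{F}}$) and reductions, the latter modulo the smallest congruence (closed under function symbols, rules, composition, substitution) generated by $\mathcal{E}_{\mathcal{T}}$ and the standard congruence. **The theory $\mathscr{M}_n$.** Function symbols: binary $\otimes_1,\dots,\otimes_n$ and a nullary $I$. Equations on terms, for $1\le i\le n$: $a\otimes_i(b\otimes_i c)=(a\otimes_i b)\otimes_i c$, $a\otimes_i I=a$, $I\otimes_i a=a$. Rules, for $1\le i<j\le n$ (interchange): $$\eta^{ij}_{a,b,c,d}:(a\otimes_j b)\otimes_i(c\otimes_j d)\to(a\otimes_i c)\otimes_j(b\otimes_i d).$$ Equations on reductions: (1) Internal unit: $\eta^{ij}_{a,b,I,I}=\eta^{ij}_{I,I,a,b}=id_{a\otimes_j b}$. (2) External unit: $\eta^{ij}_{a,I,b,I}=\eta^{ij}_{I,a,I,b}=id_{a\otimes_i b}$. (3) Internal associativity: $(\eta^{ij}_{a,b,c,d}\otimes_i id_{e\otimes_j f})\cdot\eta^{ij}_{a\otimes_i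 c,\,b\otimes_i d,\,e,\,f}=(id_{a\otimes_j b}\otimes_i\eta^{ij}_{c,d,e,f})\cdot\eta^{ij}_{a,\,b,\,c\otimes_i e,\,d\otimes_i f}$ as reductions $(a\otimes_j b)\otimes_i(c\otimes_j d)\otimes_i(e\otimes_j f)\to(a\otimes_i c\otimes_i e)\otimes_j(b\otimes_i d\otimes_i f)$. (4) External associativity: $\eta^{ij}_{a\otimes_j b,\,c,\,d\otimes_j e,\,f}\cdot(\eta^{ij}_{a,b,d,e}\otimes_j id_{c\otimes_i f})=\eta^{ij}_{a,\,b\otimes_j c,\,d,\,e\otimes_j f}\cdot(id_{a\otimes_i d}\otimes_j\eta^{ij}_{b,c,e,f})$ as reductions $(a\otimes_j b\otimes_j c)\otimes_i(d\otimes_j e\otimes_j f)\to(a\otimes_i d)\otimes_j(b\otimes_i e)\otimes_j(c\otimes_i f)$. (5) Giant hexagon, for $1\le i<j<k\le n$: the two composites from $((a\otimes_k b)\otimes_j(c\otimes_k d))\otimes_i((e\otimes_k f)\otimes_j(g\otimes_k h))$ to $((a\otimes_i e)\otimes_j(c\otimes_i g))\otimes_k((b\otimes_i f)\otimes_j(d\otimes_i h))$ are equal (with the evident components): $\eta^{jk}\otimes_i\eta^{jk}$ to $((a\otimes_j c)\otimes_k(b\otimes_j d))\otimes_i((e\otimes_j g)\otimes_k(f\otimes_j h))$, then $\eta^{ik}$ to $((a\otimes_j c)\otimes_i(e\otimes_j g))\otimes_k((b\otimes_j d)\otimes_i(f\otimes_j h))$, then $\eta^{ij}\otimes_k\eta^{ij}$;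 and $\eta^{ij}$ to $((a\otimes_k b)\otimes_i(e\otimes_k f))\otimes_j((c\otimes_k d)\otimes_i(g\otimes_k h))$, then $\eta^{ik}\otimes_j\eta^{ik}$ to $((a\otimes_i e)\otimes_k(b\otimes_i f))\otimes_j((c\otimes_i g)\otimes_k(d\otimes_i h))$, then $\eta^{jk}$. *)

theory Defs
  imports Main
begin

section \<open>Rewriting 2-theories\<close>

text \<open>
  The countably infinite set of variables is \<^typ>\<open>nat\<close>. Composition of reductions is written in
  diagrammatic order.
\<close>

datatype 'f trm = Var nat | App 'f "'f trm list"

datatype ('f, 'r) redn =
    Ident "'f trm"
  | FunR 'f "('f, 'r) redn list"
  | RuleR 'r "('f, 'r) redn list"
  | Comp "('f, 'r) redn" "('f, 'r) redn"  (infixr "\<cdot>" 60)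

text \<open>
  The source and target of a rule of arity \<open>m\<close> are given by representatives
  \<open>s(x\<^sub>1,\<dots>,x\<^sub>m)\<close> and \<open>t(x\<^sub>1,\<dots>,x\<^sub>m)\<close>, where \<open>x\<^sub>1,\<dots>,x\<^sub>m\<close> are the variables
  \<open>0,\<dots>,m-1\<close>.
\<close>

record ('f, 'r) two_theory =
  syms :: "'f set"
  arity :: "'f \<Rightarrow> nat"
  term_eqs :: "('f trm \<times> 'f trm) set"
  rules :: "'r set"
  rule_arity :: "'r \<Rightarrow> nat"
  rule_src :: "'r \<Rightarrow> 'f trm"
  rule_tgt :: "'r \<Rightarrow> 'f trm"
  redn_eqs :: "(('f, 'r) redn \<times> ('f, 'r) redn) set"

inductive_set wf_terms :: "('f, 'r) two_theory \<Rightarrow> 'f trm set" for R where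
  wf_Var: "Var x \<in> wf_terms R"
| wf_App: "\<lbrakk>f \<in> syms R; length ts = arity R f; \<forall>t\<in>set ts. t \<in> wf_terms R\<rbrakk> \<Longrightarrow> App f ts \<in> wf_terms R"

primrec vars :: "'f trm \<Rightarrow> nat list" where
  "vars (Var x) = [x]"
| "vars (App f ts) = concat (map vars ts)"

definition no_repeated_vars :: "'f trm \<Rightarrow> bool" where
  "no_repeated_vars t \<longleftrightarrow> distinct (vars t)"

primrec tsubst :: "(nat \<Rightarrow> 'f trm) \<Rightarrow> 'f trm \<Rightarrow> 'f trm" where
  "tsubst \<sigma> (Var x) = \<sigma> x"
| "tsubst \<sigma> (App f ts) = App f (map (tsubst \<sigma>) ts)"

text \<open>\<open>plug s [s\<^sub>1,\<dots>,s\<^sub>m]\<close> is \<open>s(s\<^sub>1,\<dots>,s\<^sub>m)\<close> for a term \<open>s(x\<^sub>1,\<dots>,x\<^sub>m)\<close>.\<close>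

abbreviation plug :: "'f trm \<Rightarrow> 'f trm list \<Rightarrow> 'f trm" where
  "plug s ss \<equiv> tsubst (\<lambda>k. ss ! k) s"

inductive term_eq :: "('f, 'r) two_theory \<Rightarrow> 'f trm \<Rightarrow> 'f trm \<Rightarrow> bool" for R where
  te_ax: "\<lbrakk>(s, t) \<in> term_eqs R; \<forall>x. \<sigma> x \<in> wf_terms R\<rbrakk> \<Longrightarrow> term_eq R (tsubst \<sigma> s) (tsubst \<sigma> t)"
| te_refl: "t \<in> wf_terms R \<Longrightarrow> term_eq R t t"
| te_sym: "term_eq R s t \<Longrightarrow> term_eq R t s"
| te_trans: "\<lbrakk>term_eq R s t; term_eq R t u\<rbrakk> \<Longrightarrow> term_eq R s u"
| te_cong: "\<lbrakk>f \<in> syms R; length ss = arity R f; length ts = arity R f;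
    \<forall>k<arity R f. term_eq R (ss ! k) (ts ! k)\<rbrakk> \<Longrightarrow> term_eq R (App f ss) (App f ts)"

text \<open>
  \<open>is_redn R \<phi> s t\<close> means \<open>\<phi> : [s] \<rightarrow> [t]\<close>. Rule \<open>red_conv\<close> makes this a relation between
  classes of terms modulo the equational theory.
\<close>

inductive is_redn :: "('f, 'r) two_theory \<Rightarrow> ('f, 'r) redn \<Rightarrow> 'f trm \<Rightarrow> 'f trm \<Rightarrow> bool" for R where
  red_id: "s \<in> wf_terms R \<Longrightarrow> is_redn R (Ident s) s s"
| red_fun: "\<lbrakk>f \<in> syms R; length \<phi>s = arity R f; length ss = arity R f; length ts = arity R f;
    \<forall>k<arity R f. is_redn R (\<phi>s ! k) (ss ! k) (ts ! k)\<rbrakk>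
    \<Longrightarrow> is_redn R (FunR f \<phi>s) (App f ss) (App f ts)"
| red_rule: "\<lbrakk>r \<in> rules R; length \<phi>s = rule_arity R r;
    length ss = rule_arity R r; length ts = rule_arity R r;
    \<forall>k<rule_arity R r. is_redn R (\<phi>s ! k) (ss ! k) (ts ! k)\<rbrakk>
    \<Longrightarrow> is_redn R (RuleR r \<phi>s) (plug (rule_src R r) ss) (plug (rule_tgt R r) ts)"
| red_comp: "\<lbrakk>is_redn R \<phi> s t; is_redn R \<psi> t u\<rbrakk> \<Longrightarrow> is_redn R (\<phi> \<cdot> \<psi>) s u"
| red_conv: "\<lbrakk>is_redn R \<phi> s t; term_eq R s s'; term_eq R t t'\<rbrakk> \<Longrightarrow> is_redn R \<phi> s' t'"

text \<open>
  Substitution of reductions \<open>\<theta> x : [\<sigma> x] \<rightarrow> [\<tau> x]\<close> for variables: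
  \<open>tsubst_redn \<theta> s\<close> is \<open>s(\<theta>)\<close>, and \<open>subst_redn \<tau> \<theta> \<phi>\<close> is \<open>\<phi>(\<theta>)\<close>. In a composite,
  \<open>\<theta>\<close> goes into the first factor and the second factor is instantiated at the targets \<open>\<tau>\<close>.
  Instantiation at terms, \<open>\<phi>(1\<^sub>\<sigma>)\<close>, is the special case in which all \<open>\<theta> x\<close> are identities.
\<close>

primrec tsubst_redn :: "(nat \<Rightarrow> ('f, 'r) redn) \<Rightarrow> 'f trm \<Rightarrow> ('f, 'r) redn" where
  "tsubst_redn \<theta> (Var x) = \<theta> x"
| "tsubst_redn \<theta> (App f ts) = FunR f (map (tsubst_redn \<theta>) ts)"

primrec subst_redn :: "(nat \<Rightarrow> 'f trm) \<Rightarrow> (nat \<Rightarrow> ('f, 'r) redn) \<Rightarrow> ('f, 'r) redn \<Rightarrow> ('f, 'r) redn" where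
  "subst_redn \<tau> \<theta> (Ident s) = tsubst_redn \<theta> s"
| "subst_redn \<tau> \<theta> (FunR f \<phi>s) = FunR f (map (subst_redn \<tau> \<theta>) \<phi>s)"
| "subst_redn \<tau> \<theta> (RuleR r \<phi>s) = RuleR r (map (subst_redn \<tau> \<theta>) \<phi>s)"
| "subst_redn \<tau> \<theta> (\<phi> \<cdot> \<psi>) = subst_redn \<tau> \<theta> \<phi> \<cdot> subst_redn \<tau> (\<lambda>x. Ident (\<tau> x)) \<psi>"

abbreviation inst_redn :: "(nat \<Rightarrow> 'f trm) \<Rightarrow> ('f, 'r) redn \<Rightarrow> ('f, 'r) redn" where
  "inst_redn \<sigma> \<phi> \<equiv> subst_redn \<sigma> (\<lambda>x. Ident (\<sigma> x)) \<phi>"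

text \<open>
  \<open>redn_eq R \<phi> \<psi> s t\<close> means that \<open>\<phi>\<close> and \<open>\<psi>\<close> are congruent reductions \<open>[s] \<rightarrow> [t]\<close>. It is the
  smallest congruence containing \<open>redn_eqs R\<close> and the standard congruence. Rule \<open>re_ident\<close>
  expresses that \<open>1\<^sub>s\<close> depends only on \<open>[s]\<close>, and \<open>re_fun_id\<close> that \<open>F(1,\<dots>,1) = 1\<close>; rules
  \<open>re_nat1\<close> and \<open>re_nat2\<close> are the two expressions for \<open>\<phi>(\<phi>\<^sub>1,\<dots>,\<phi>\<^sub>m)\<close>.
\<close>

inductive redn_eq ::
  "('f, 'r) two_theory \<Rightarrow> ('f, 'r) redn \<Rightarrow> ('f, 'r) redn \<Rightarrow> 'f trm \<Rightarrow> 'f trm \<Rightarrow> bool" for R where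
  re_ax: "\<lbrakk>(\<phi>, \<psi>) \<in> redn_eqs R; is_redn R \<phi> s t; is_redn R \<psi> s t\<rbrakk> \<Longrightarrow> redn_eq R \<phi> \<psi> s t"
| re_refl: "is_redn R \<phi> s t \<Longrightarrow> redn_eq R \<phi> \<phi> s t"
| re_sym: "redn_eq R \<phi> \<psi> s t \<Longrightarrow> redn_eq R \<psi> \<phi> s t"
| re_trans: "\<lbrakk>redn_eq R \<phi> \<psi> s t; redn_eq R \<psi> \<chi> s t\<rbrakk> \<Longrightarrow> redn_eq R \<phi> \<chi> s t"
| re_conv: "\<lbrakk>redn_eq R \<phi> \<psi> s t; term_eq R s s'; term_eq R t t'\<rbrakk> \<Longrightarrow> redn_eq R \<phi> \<psi> s' t'"
| re_ident: "term_eq R s s' \<Longrightarrow> redn_eq R (Ident s) (Ident s') s s"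
| re_fun: "\<lbrakk>f \<in> syms R; length \<phi>s = arity R f; length \<psi>s = arity R f;
    length ss = arity R f; length ts = arity R f;
    \<forall>k<arity R f. redn_eq R (\<phi>s ! k) (\<psi>s ! k) (ss ! k) (ts ! k)\<rbrakk>
    \<Longrightarrow> redn_eq R (FunR f \<phi>s) (FunR f \<psi>s) (App f ss) (App f ts)"
| re_rule: "\<lbrakk>r \<in> rules R; length \<phi>s = rule_arity R r; length \<psi>s = rule_arity R r;
    length ss = rule_arity R r; length ts = rule_arity R r;
    \<forall>k<rule_arity R r. redn_eq R (\<phi>s ! k) (\<psi>s ! k) (ss ! k) (ts ! k)\<rbrakk>
    \<Longrightarrow> redn_eq R (RuleR r \<phi>s) (RuleR r \<psi>s) (plug (rule_src R r) ss) (plug (rule_tgt R r) ts)"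
| re_comp: "\<lbrakk>redn_eq R \<phi> \<phi>' s t; redn_eq R \<psi> \<psi>' t u\<rbrakk> \<Longrightarrow> redn_eq R (\<phi> \<cdot> \<psi>) (\<phi>' \<cdot> \<psi>') s u"
| re_subst: "\<lbrakk>redn_eq R \<phi> \<psi> s t; \<forall>x. redn_eq R (\<theta> x) (\<theta>' x) (\<sigma> x) (\<tau> x);
    \<forall>x. \<sigma> x \<in> wf_terms R; \<forall>x. \<tau> x \<in> wf_terms R\<rbrakk>
    \<Longrightarrow> redn_eq R (subst_redn \<tau> \<theta> \<phi>) (subst_redn \<tau> \<theta>' \<psi>) (tsubst \<sigma> s) (tsubst \<tau> t)"
| re_id_left: "is_redn R \<phi> s t \<Longrightarrow> redn_eq R (Ident s \<cdot> \<phi>) \<phi> s t"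
| re_id_right: "is_redn R \<phi> s t \<Longrightarrow> redn_eq R (\<phi> \<cdot> Ident t) \<phi> s t"
| re_assoc: "\<lbrakk>is_redn R \<phi> s t; is_redn R \<psi> t u; is_redn R \<chi> u v\<rbrakk>
    \<Longrightarrow> redn_eq R ((\<phi> \<cdot> \<psi>) \<cdot> \<chi>) (\<phi> \<cdot> (\<psi> \<cdot> \<chi>)) s v"
| re_fun_id: "\<lbrakk>f \<in> syms R; length ss = arity R f; \<forall>s\<in>set ss. s \<in> wf_terms R\<rbrakk>
    \<Longrightarrow> redn_eq R (FunR f (map Ident ss)) (Ident (App f ss)) (App f ss) (App f ss)"
| re_fun_comp: "\<lbrakk>f \<in> syms R; length \<phi>s = arity R f; length \<psi>s = arity R f;
    length ss = arity R f; length ts = arity R f; length us = arity R f;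
    \<forall>k<arity R f. is_redn R (\<phi>s ! k) (ss ! k) (ts ! k);
    \<forall>k<arity R f. is_redn R (\<psi>s ! k) (ts ! k) (us ! k)\<rbrakk>
    \<Longrightarrow> redn_eq R (FunR f \<phi>s \<cdot> FunR f \<psi>s) (FunR f (map2 (\<cdot>) \<phi>s \<psi>s)) (App f ss) (App f us)"
| re_nat1: "\<lbrakk>is_redn R \<phi> s t; \<forall>x. is_redn R (\<theta> x) (\<sigma> x) (\<tau> x);
    s \<in> wf_terms R; \<forall>x. \<sigma> x \<in> wf_terms R; \<forall>x. \<tau> x \<in> wf_terms R\<rbrakk>
    \<Longrightarrow> redn_eq R (subst_redn \<tau> \<theta> \<phi>) (tsubst_redn \<theta> s \<cdot> inst_redn \<tau> \<phi>) (tsubst \<sigma> s) (tsubst \<tau> t)"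
| re_nat2: "\<lbrakk>is_redn R \<phi> s t; \<forall>x. is_redn R (\<theta> x) (\<sigma> x) (\<tau> x);
    t \<in> wf_terms R; \<forall>x. \<sigma> x \<in> wf_terms R; \<forall>x. \<tau> x \<in> wf_terms R\<rbrakk>
    \<Longrightarrow> redn_eq R (subst_redn \<tau> \<theta> \<phi>) (inst_redn \<sigma> \<phi> \<cdot> tsubst_redn \<theta> t) (tsubst \<sigma> s) (tsubst \<tau> t)"

text \<open>The reductions \<open>[a] \<rightarrow> [b]\<close> modulo congruence.\<close>

definition reductions :: "('f, 'r) two_theory \<Rightarrow> 'f trm \<Rightarrow> 'f trm \<Rightarrow> ('f, 'r) redn set set" where
  "reductions R a b = {\<phi>. is_redn R \<phi> a b} // {(\<phi>, \<psi>). redn_eq R \<phi> \<psi> a b}"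

text \<open>Well-formedness of a presentation; in particular the equated reductions are parallel.\<close>

definition is_two_theory :: "('f, 'r) two_theory \<Rightarrow> bool" where
  "is_two_theory R \<longleftrightarrow>
     (\<forall>(s, t)\<in>term_eqs R. s \<in> wf_terms R \<and> t \<in> wf_terms R) \<and>
     (\<forall>r\<in>rules R. rule_src R r \<in> wf_terms R \<and> rule_tgt R r \<in> wf_terms R \<and>
        set (vars (rule_src R r)) \<subseteq> {..<rule_arity R r} \<and>
        set (vars (rule_tgt R r)) \<subseteq> {..<rule_arity R r}) \<and>
     (\<forall>(\<phi>, \<psi>)\<in>redn_eqs R. \<exists>s t. is_redn R \<phi> s t \<and> is_redn R \<psi> s t)"


subsection \<open>Congruence is an equivalence relation on parallel reductions\<close>

lemma tsubst_cong: "(\<And>x. x \<in> set (vars t) \<Longrightarrow> \<sigma> x = \<tau> x) \<Longrightarrow> tsubst \<sigma> t = tsubst \<tau> t"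
  by (induction t) auto

lemma tsubst_tsubst: "tsubst \<sigma> (tsubst \<tau> t) = tsubst (\<lambda>x. tsubst \<sigma> (\<tau> x)) t"
  by (induction t) auto

lemma wf_tsubst: "t \<in> wf_terms R \<Longrightarrow> \<forall>x\<in>set (vars t). \<sigma> x \<in> wf_terms R \<Longrightarrow> tsubst \<sigma> t \<in> wf_terms R"
  by (induction rule: wf_terms.induct) (auto intro!: wf_App)

lemma term_eq_wf:
  assumes "is_two_theory R"
  shows "term_eq R s t \<Longrightarrow> s \<in> wf_terms R \<and> t \<in> wf_terms R"
proof (induction rule: term_eq.induct)
  case (te_ax s t \<sigma>) then show ?case using assms by (auto simp: is_two_theory_def intro!: wf_tsubst)
next
  case (te_cong f ss ts) then show ?case by (auto intro!: wf_App simp: in_set_conv_nth)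
qed auto

lemma term_eq_tsubst:
  "term_eq R s t \<Longrightarrow> \<forall>x. \<sigma> x \<in> wf_terms R \<Longrightarrow> term_eq R (tsubst \<sigma> s) (tsubst \<sigma> t)"
proof (induction rule: term_eq.induct)
  case (te_ax s t \<tau>) then show ?case
    unfolding tsubst_tsubst by (auto intro!: term_eq.te_ax wf_tsubst)
next
  case (te_refl t) then show ?case by (auto intro!: term_eq.te_refl wf_tsubst)
next
  case (te_trans) then show ?case by (blast intro: term_eq.te_trans)
next
  case (te_cong f ss ts) then show ?case by (auto intro!: term_eq.te_cong)
qed (auto intro: term_eq.te_sym)

lemma ruleD:
  assumes "is_two_theory R" "r \<in> rules R"
  shows "rule_src R r \<in> wf_terms R" "rule_tgt R r \<in> wf_terms R"
    "\<And>x. x \<in> set (vars (rule_src R r)) \<Longrightarrow> x < rule_arity R r"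
    "\<And>x. x \<in> set (vars (rule_tgt R r)) \<Longrightarrow> x < rule_arity R r"
  using assms by (auto simp: is_two_theory_def)

lemma is_redn_wf:
  assumes "is_two_theory R"
  shows "is_redn R \<phi> s t \<Longrightarrow> s \<in> wf_terms R \<and> t \<in> wf_terms R"
proof (induction rule: is_redn.induct)
  case red_fun then show ?case by (auto intro!: wf_App simp: in_set_conv_nth)
next
  case (red_rule r \<phi>s ss ts) then show ?case
    using ruleD[OF assms red_rule(1)] by (auto intro!: wf_tsubst)
next
  case red_conv then show ?case using term_eq_wf[OF assms] by blast
qed auto

lemma tsubst_redn_is:
  "s \<in> wf_terms R \<Longrightarrow> \<forall>x. is_redn R (\<theta> x) (\<sigma> x) (\<tau> x)
   \<Longrightarrow> is_redn R (tsubst_redn \<theta> s) (tsubst \<sigma> s) (tsubst \<tau> s)"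
  by (induction rule: wf_terms.induct) (auto intro!: red_fun)

lemma term_eq_tsubst2: "is_two_theory R \<Longrightarrow> term_eq R s t \<Longrightarrow> \<forall>x. is_redn R (\<theta> x) (\<sigma> x) (\<tau> x) \<Longrightarrow>
   term_eq R (tsubst \<sigma> s) (tsubst \<sigma> t) \<and> term_eq R (tsubst \<tau> s) (tsubst \<tau> t)"
  using is_redn_wf by (blast intro!: term_eq_tsubst)

lemma plug_tsubst:
  "length ss = m \<Longrightarrow> (\<And>x. x \<in> set (vars s) \<Longrightarrow> x < m) \<Longrightarrow> tsubst \<sigma> (plug s ss) = plug s (map (tsubst \<sigma>) ss)"
  unfolding tsubst_tsubst by (rule tsubst_cong) auto

lemma subst_redn_is:
  assumes T: "is_two_theory R"
  shows "is_redn R \<phi> s t \<Longrightarrow> \<forall>x. is_redn R (\<theta> x) (\<sigma> x) (\<tau> x)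
   \<Longrightarrow> is_redn R (subst_redn \<tau> \<theta> \<phi>) (tsubst \<sigma> s) (tsubst \<tau> t)"
proof (induction arbitrary: \<theta> \<sigma> rule: is_redn.induct)
  case red_id then show ?case by (auto intro: tsubst_redn_is)
next
  case red_fun then show ?case by (auto intro!: is_redn.red_fun)
next
  case (red_rule r \<phi>s ss ts)
  note r = ruleD[OF T red_rule(1)]
  have "tsubst \<sigma> (plug (rule_src R r) ss) = plug (rule_src R r) (map (tsubst \<sigma>) ss)"
    "tsubst \<tau> (plug (rule_tgt R r) ts) = plug (rule_tgt R r) (map (tsubst \<tau>) ts)"
    using r red_rule by (auto intro!: plug_tsubst)
  moreover have "is_redn R (subst_redn \<tau> \<theta> (RuleR r \<phi>s)) (plug (rule_src R r) (map (tsubst \<sigma>) ss))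
     (plug (rule_tgt R r) (map (tsubst \<tau>) ts))"
    unfolding subst_redn.simps using red_rule by (intro is_redn.red_rule) auto
  ultimately show ?case by metis
next
  case (red_comp \<phi> s t \<psi> u)
  have "\<forall>x. is_redn R (Ident (\<tau> x)) (\<tau> x) (\<tau> x)"
    using is_redn_wf[OF T] red_comp(5) by (blast intro: red_id)
  then show ?case using red_comp.IH(1)[OF red_comp.prems] red_comp.IH(2) by (auto intro: is_redn.red_comp)
next
  case (red_conv \<phi> s t s' t')
  then show ?case using term_eq_tsubst2[OF T] by (blast intro: is_redn.red_conv)
qed

lemma redn_eq_is_redn:
  assumes T: "is_two_theory R"
  shows "redn_eq R \<phi> \<psi> s t \<Longrightarrow> is_redn R \<phi> s t \<and> is_redn R \<psi> s t"
proof (induction rule: redn_eq.induct)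
  case re_conv then show ?case by (blast intro: red_conv)
next
  case re_ident then show ?case using term_eq_wf[OF T] by (blast intro: red_conv red_id te_sym te_refl)
next
  case re_fun then show ?case by (auto intro!: red_fun)
next
  case re_rule then show ?case by (auto intro!: red_rule)
next
  case re_comp then show ?case by (blast intro: red_comp)
next
  case re_subst then show ?case by (blast intro: subst_redn_is[OF T])
next
  case (re_id_left \<phi> s t) then show ?case using is_redn_wf[OF T] by (blast intro: red_comp red_id)
next
  case (re_id_right \<phi> s t) then show ?case using is_redn_wf[OF T] by (blast intro: red_comp red_id)
next
  case re_assoc then show ?case by (blast intro: red_comp)
next
  case re_fun_id then show ?case by (auto intro!: red_fun red_id wf_App)
next
  case (re_fun_comp f \<phi>s \<psi>s ss ts us)
  have "is_redn R (FunR f \<phi>s \<cdot> FunR f \<psi>s) (App f ss) (App f us)"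
    using re_fun_comp by (intro red_comp[of R _ _ "App f ts"] red_fun) auto
  moreover have "is_redn R (FunR f (map2 (\<cdot>) \<phi>s \<psi>s)) (App f ss) (App f us)"
    using re_fun_comp by (intro red_fun) (auto intro: red_comp)
  ultimately show ?case by blast
next
  case (re_nat1 \<phi> s t \<theta> \<sigma> \<tau>)
  have "\<forall>x. is_redn R (Ident (\<tau> x)) (\<tau> x) (\<tau> x)" using re_nat1 by (blast intro: red_id)
  then show ?case using re_nat1 by (blast intro: red_comp subst_redn_is[OF T] tsubst_redn_is)
next
  case (re_nat2 \<phi> s t \<theta> \<sigma> \<tau>)
  have "\<forall>x. is_redn R (Ident (\<sigma> x)) (\<sigma> x) (\<sigma> x)" using re_nat2 by (blast intro: red_id)
  then show ?case using re_nat2 by (blast intro: red_comp subst_redn_is[OF T] tsubst_redn_is)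
qed auto

lemma equiv_redn_eq:
  assumes T: "is_two_theory R"
  shows "equiv {\<phi>. is_redn R \<phi> a b} {(\<phi>, \<psi>). redn_eq R \<phi> \<psi> a b}"
  by (rule equivI) (auto simp: refl_on_def sym_def trans_def intro: re_refl re_sym re_trans dest: redn_eq_is_redn[OF T])


section \<open>The theory of n-fold monoidal categories\<close>

datatype mon_sym = Tensor nat | Unit

type_synonym mon_trm = "mon_sym trm"
type_synonym mon_redn = "(mon_sym, nat \<times> nat) redn"

abbreviation \<I> :: mon_trm where
  "\<I> \<equiv> App Unit []"

abbreviation tensor :: "mon_trm \<Rightarrow> nat \<Rightarrow> mon_trm \<Rightarrow> mon_trm"  ("_ \<otimes>\<^bsub>_\<^esub> _" [66, 0, 66] 65) where
  "a \<otimes>\<^bsub>i\<^esub> b \<equiv> App (Tensor i) [a, b]"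

abbreviation tensor_redn :: "mon_redn \<Rightarrow> nat \<Rightarrow> mon_redn \<Rightarrow> mon_redn"  ("_ \<^bold>\<otimes>\<^bsub>_\<^esub> _" [66, 0, 66] 65) where
  "\<phi> \<^bold>\<otimes>\<^bsub>i\<^esub> \<psi> \<equiv> FunR (Tensor i) [\<phi>, \<psi>]"

abbreviation eta :: "nat \<Rightarrow> nat \<Rightarrow> mon_trm \<Rightarrow> mon_trm \<Rightarrow> mon_trm \<Rightarrow> mon_trm \<Rightarrow> mon_redn" where
  "eta i j a b c d \<equiv> RuleR (i, j) [Ident a, Ident b, Ident c, Ident d]"

fun mon_arity :: "mon_sym \<Rightarrow> nat" where
  "mon_arity (Tensor i) = 2"
| "mon_arity Unit = 0"

text \<open>
  The equations below are stated for variables; all their instances at terms follow from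
  \<open>te_ax\<close> and \<open>re_subst\<close>.
\<close>

definition mon_term_eqs :: "nat \<Rightarrow> (mon_trm \<times> mon_trm) set" where
  "mon_term_eqs n = (let a = Var 0; b = Var 1; c = Var 2 in
     \<Union>i\<in>{1..n}.
       {(a \<otimes>\<^bsub>i\<^esub> (b \<otimes>\<^bsub>i\<^esub> c), (a \<otimes>\<^bsub>i\<^esub> b) \<otimes>\<^bsub>i\<^esub> c),
        (a \<otimes>\<^bsub>i\<^esub> \<I>, a),
        (\<I> \<otimes>\<^bsub>i\<^esub> a, a)})"

definition unit_eqs :: "nat \<Rightarrow> nat \<Rightarrow> (mon_redn \<times> mon_redn) set" where
  "unit_eqs i j = (let a = Var 0; b = Var 1 in
     {(eta i j a b \<I> \<I>, Ident (a \<otimes>\<^bsub>j\<^esub> b)),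
      (eta i j \<I> \<I> a b, Ident (a \<otimes>\<^bsub>j\<^esub> b)),
      (eta i j a \<I> b \<I>, Ident (a \<otimes>\<^bsub>i\<^esub> b)),
      (eta i j \<I> a \<I> b, Ident (a \<otimes>\<^bsub>i\<^esub> b))})"

definition assoc_eqs :: "nat \<Rightarrow> nat \<Rightarrow> (mon_redn \<times> mon_redn) set" where
  "assoc_eqs i j = (let a = Var 0; b = Var 1; c = Var 2; d = Var 3; e = Var 4; f = Var 5 in
     {((eta i j a b c d \<^bold>\<otimes>\<^bsub>i\<^esub> Ident (e \<otimes>\<^bsub>j\<^esub> f)) \<cdot> eta i j (a \<otimes>\<^bsub>i\<^esub> c) (b \<otimes>\<^bsub>i\<^esub> d) e f,
       (Ident (a \<otimes>\<^bsub>j\<^esub> b) \<^bold>\<otimes>\<^bsub>i\<^esub> eta i j c d e f) \<cdot> eta i j a b (c \<otimes>\<^bsub>i\<^esub> e) (d \<otimes>\<^bsub>i\<^esub> f)),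
      (eta i j (a \<otimes>\<^bsub>j\<^esub> b) c (d \<otimes>\<^bsub>j\<^esub> e) f \<cdot> (eta i j a b d e \<^bold>\<otimes>\<^bsub>j\<^esub> Ident (c \<otimes>\<^bsub>i\<^esub> f)),
       eta i j a (b \<otimes>\<^bsub>j\<^esub> c) d (e \<otimes>\<^bsub>j\<^esub> f) \<cdot> (Ident (a \<otimes>\<^bsub>i\<^esub> d) \<^bold>\<otimes>\<^bsub>j\<^esub> eta i j b c e f))})"

definition hexagon_eqs :: "nat \<Rightarrow> nat \<Rightarrow> nat \<Rightarrow> (mon_redn \<times> mon_redn) set" where
  "hexagon_eqs i j k = (let a = Var 0; b = Var 1; c = Var 2; d = Var 3;
                            e = Var 4; f = Var 5; g = Var 6; h = Var 7 in
     {((eta j k a b c d \<^bold>\<otimes>\<^bsub>i\<^esub> eta j k e f g h)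
         \<cdot> eta i k (a \<otimes>\<^bsub>j\<^esub> c) (b \<otimes>\<^bsub>j\<^esub> d) (e \<otimes>\<^bsub>j\<^esub> g) (f \<otimes>\<^bsub>j\<^esub> h)
         \<cdot> (eta i j a c e g \<^bold>\<otimes>\<^bsub>k\<^esub> eta i j b d f h),
       eta i j (a \<otimes>\<^bsub>k\<^esub> b) (c \<otimes>\<^bsub>k\<^esub> d) (e \<otimes>\<^bsub>k\<^esub> f) (g \<otimes>\<^bsub>k\<^esub> h)
         \<cdot> (eta i k a b e f \<^bold>\<otimes>\<^bsub>j\<^esub> eta i k c d g h)
         \<cdot> eta j k (a \<otimes>\<^bsub>i\<^esub> e) (b \<otimes>\<^bsub>i\<^esub> f) (c \<otimes>\<^bsub>i\<^esub> g) (d \<otimes>\<^bsub>i\<^esub> h))})"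

definition Mon :: "nat \<Rightarrow> (mon_sym, nat \<times> nat) two_theory" where
  "Mon n = \<lparr>
     syms = insert Unit (Tensor ` {1..n}),
     arity = mon_arity,
     term_eqs = mon_term_eqs n,
     rules = {(i, j). 1 \<le> i \<and> i < j \<and> j \<le> n},
     rule_arity = (\<lambda>_. 4),
     rule_src = (\<lambda>(i, j). (Var 0 \<otimes>\<^bsub>j\<^esub> Var 1) \<otimes>\<^bsub>i\<^esub> (Var 2 \<otimes>\<^bsub>j\<^esub> Var 3)),
     rule_tgt = (\<lambda>(i, j). (Var 0 \<otimes>\<^bsub>i\<^esub> Var 2) \<otimes>\<^bsub>j\<^esub> (Var 1 \<otimes>\<^bsub>i\<^esub> Var 3)),
     redn_eqs =
       (\<Union>(i, j)\<in>{(i, j). 1 \<le> i \<and> i < j \<and> j \<le> n}. unit_eqs i j \<union> assoc_eqs i j) \<union>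
       (\<Union>(i, j, k)\<in>{(i, j, k). 1 \<le> i \<and> i < j \<and> j < k \<and> k \<le> n}. hexagon_eqs i j k)\<rparr>"


subsection \<open>Well-formedness of the presentation\<close>

lemma wf_tensor:
  "\<lbrakk>a \<in> wf_terms (Mon n); b \<in> wf_terms (Mon n); i \<in> {1..n}\<rbrakk> \<Longrightarrow> a \<otimes>\<^bsub>i\<^esub> b \<in> wf_terms (Mon n)"
  by (rule wf_App) (auto simp: Mon_def)

lemma wf_unit: "\<I> \<in> wf_terms (Mon n)"
  by (rule wf_App) (auto simp: Mon_def)

lemmas wf_mon = wf_tensor wf_unit wf_Var

lemma te_tensor:
  assumes "term_eq (Mon n) a a'" "term_eq (Mon n) b b'" "i \<in> {1..n}"
  shows "term_eq (Mon n) (a \<otimes>\<^bsub>i\<^esub> b) (a' \<otimes>\<^bsub>i\<^esub> b')"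
  using assms by (intro te_cong) (auto simp: Mon_def less_2_cases_iff)

lemma
  assumes "i \<in> {1..n}" "a \<in> wf_terms (Mon n)" "b \<in> wf_terms (Mon n)" "c \<in> wf_terms (Mon n)"
  shows te_assoc: "term_eq (Mon n) (a \<otimes>\<^bsub>i\<^esub> (b \<otimes>\<^bsub>i\<^esub> c)) ((a \<otimes>\<^bsub>i\<^esub> b) \<otimes>\<^bsub>i\<^esub> c)"
    and te_unit_right: "term_eq (Mon n) (a \<otimes>\<^bsub>i\<^esub> \<I>) a"
    and te_unit_left: "term_eq (Mon n) (\<I> \<otimes>\<^bsub>i\<^esub> a) a"
proof -
  let ?\<sigma> = "\<lambda>x::nat. if x = 0 then a else if x = 1 then b else c"
  have eqs: "(Var 0 \<otimes>\<^bsub>i\<^esub> (Var 1 \<otimes>\<^bsub>i\<^esub> Var 2), (Var 0 \<otimes>\<^bsub>i\<^esub> Var 1) \<otimes>\<^bsub>i\<^esub> Var 2) \<in> term_eqs (Mon n)"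
    "(Var 0 \<otimes>\<^bsub>i\<^esub> \<I>, Var 0) \<in> term_eqs (Mon n)" "(\<I> \<otimes>\<^bsub>i\<^esub> Var 0, Var 0) \<in> term_eqs (Mon n)"
    using assms(1) by (auto simp: Mon_def mon_term_eqs_def Let_def)
  have \<sigma>: "\<forall>x. ?\<sigma> x \<in> wf_terms (Mon n)"
    using assms by simp
  show "term_eq (Mon n) (a \<otimes>\<^bsub>i\<^esub> (b \<otimes>\<^bsub>i\<^esub> c)) ((a \<otimes>\<^bsub>i\<^esub> b) \<otimes>\<^bsub>i\<^esub> c)"
    "term_eq (Mon n) (a \<otimes>\<^bsub>i\<^esub> \<I>) a" "term_eq (Mon n) (\<I> \<otimes>\<^bsub>i\<^esub> a) a"
    using te_ax[OF eqs(1) \<sigma>] te_ax[OF eqs(2) \<sigma>] te_ax[OF eqs(3) \<sigma>] by simp_all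
qed

lemma red_tensor:
  assumes "is_redn (Mon n) \<phi> a a'" "is_redn (Mon n) \<psi> b b'" "i \<in> {1..n}"
  shows "is_redn (Mon n) (\<phi> \<^bold>\<otimes>\<^bsub>i\<^esub> \<psi>) (a \<otimes>\<^bsub>i\<^esub> b) (a' \<otimes>\<^bsub>i\<^esub> b')"
  using assms by (intro red_fun) (auto simp: Mon_def less_2_cases_iff)

lemma red_eta:
  assumes "1 \<le> i" "i < j" "j \<le> n" "a \<in> wf_terms (Mon n)" "b \<in> wf_terms (Mon n)"
    "c \<in> wf_terms (Mon n)" "d \<in> wf_terms (Mon n)"
  shows "is_redn (Mon n) (eta i j a b c d)
    ((a \<otimes>\<^bsub>j\<^esub> b) \<otimes>\<^bsub>i\<^esub> (c \<otimes>\<^bsub>j\<^esub> d)) ((a \<otimes>\<^bsub>i\<^esub> c) \<otimes>\<^bsub>j\<^esub> (b \<otimes>\<^bsub>i\<^esub> d))"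
proof -
  have "is_redn (Mon n) (eta i j a b c d)
     (plug (rule_src (Mon n) (i, j)) [a, b, c, d]) (plug (rule_tgt (Mon n) (i, j)) [a, b, c, d])"
    using assms by (intro red_rule) (auto simp: Mon_def numeral_eq_Suc less_Suc_eq intro!: red_id)
  then show ?thesis
    by (simp add: Mon_def numeral_eq_Suc)
qed

lemma te_tensor_unit:
  assumes "term_eq (Mon n) x x'" "term_eq (Mon n) y \<I>" "i \<in> {1..n}" "x' \<in> wf_terms (Mon n)"
  shows "term_eq (Mon n) (x \<otimes>\<^bsub>i\<^esub> y) x'" "term_eq (Mon n) (y \<otimes>\<^bsub>i\<^esub> x) x'"
  using te_trans[OF te_tensor[OF assms(1,2,3)] te_unit_right] te_trans[OF te_tensor[OF assms(2,1,3)] te_unit_left]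
    assms by blast+

lemma unit_eqs_parallel:
  assumes "1 \<le> i" "i < j" "j \<le> n" "(\<phi>, \<psi>) \<in> unit_eqs i j"
  shows "\<exists>s t. is_redn (Mon n) \<phi> s t \<and> is_redn (Mon n) \<psi> s t"
proof -
  let ?a = "Var 0 :: mon_trm" and ?b = "Var 1 :: mon_trm"
  have ij: "i \<in> {1..n}" "j \<in> {1..n}" using assms by auto
  have wf [simp]: "\<And>x. Var x \<in> wf_terms (Mon n)" "\<I> \<in> wf_terms (Mon n)"
    "\<And>k a b. \<lbrakk>k \<in> {1..n}; a \<in> wf_terms (Mon n); b \<in> wf_terms (Mon n)\<rbrakk> \<Longrightarrow> a \<otimes>\<^bsub>k\<^esub> b \<in> wf_terms (Mon n)"
    using wf_mon by auto
  have id: "is_redn (Mon n) (Ident (?a \<otimes>\<^bsub>k\<^esub> ?b)) (?a \<otimes>\<^bsub>k\<^esub> ?b) (?a \<otimes>\<^bsub>k\<^esub> ?b)" if "k \<in> {i, j}" for k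
    using that ij by (auto intro!: red_id)
  note eta = red_conv[OF red_eta[OF assms(1-3)]]
  have II: "term_eq (Mon n) (\<I> \<otimes>\<^bsub>k\<^esub> \<I>) \<I>" if "k \<in> {1..n}" for k
    using te_unit_right[OF that wf(2,2,2)] .
  note un = te_tensor_unit
  have "is_redn (Mon n) (eta i j ?a ?b \<I> \<I>) (?a \<otimes>\<^bsub>j\<^esub> ?b) (?a \<otimes>\<^bsub>j\<^esub> ?b)"
    using ij by (intro eta te_tensor un(1) II te_refl) auto
  moreover have "is_redn (Mon n) (eta i j \<I> \<I> ?a ?b) (?a \<otimes>\<^bsub>j\<^esub> ?b) (?a \<otimes>\<^bsub>j\<^esub> ?b)"
    using ij by (intro eta te_tensor un(2) II te_refl) auto
  moreover have "is_redn (Mon n) (eta i j ?a \<I> ?b \<I>) (?a \<otimes>\<^bsub>i\<^esub> ?b) (?a \<otimes>\<^bsub>i\<^esub> ?b)"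
    using ij by (intro eta te_tensor[of n "?a \<otimes>\<^bsub>j\<^esub> \<I>"] un(1) II te_refl) auto
  moreover have "is_redn (Mon n) (eta i j \<I> ?a \<I> ?b) (?a \<otimes>\<^bsub>i\<^esub> ?b) (?a \<otimes>\<^bsub>i\<^esub> ?b)"
    using ij by (intro eta te_tensor[of n "\<I> \<otimes>\<^bsub>j\<^esub> ?a"] un(2) II te_refl) auto
  ultimately show ?thesis
    using assms(4) id unfolding unit_eqs_def Let_def by blast
qed

lemma assoc_eqs_parallel:
  assumes "1 \<le> i" "i < j" "j \<le> n" "(\<phi>, \<psi>) \<in> assoc_eqs i j"
  shows "\<exists>s t. is_redn (Mon n) \<phi> s t \<and> is_redn (Mon n) \<psi> s t"
proof -
  let ?a = "Var 0 :: mon_trm" and ?b = "Var 1 :: mon_trm" and ?c = "Var 2 :: mon_trm"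
    and ?d = "Var 3 :: mon_trm" and ?e = "Var 4 :: mon_trm" and ?f = "Var 5 :: mon_trm"
  have ij: "i \<in> {1..n}" "j \<in> {1..n}" using assms by auto
  note wf = wf_tensor wf_unit wf_Var
  note eta = red_eta[OF assms(1-3)]
  have "is_redn (Mon n)
     ((eta i j ?a ?b ?c ?d \<^bold>\<otimes>\<^bsub>i\<^esub> Ident (?e \<otimes>\<^bsub>j\<^esub> ?f)) \<cdot> eta i j (?a \<otimes>\<^bsub>i\<^esub> ?c) (?b \<otimes>\<^bsub>i\<^esub> ?d) ?e ?f)
     (((?a \<otimes>\<^bsub>j\<^esub> ?b) \<otimes>\<^bsub>i\<^esub> (?c \<otimes>\<^bsub>j\<^esub> ?d)) \<otimes>\<^bsub>i\<^esub> (?e \<otimes>\<^bsub>j\<^esub> ?f))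
     (((?a \<otimes>\<^bsub>i\<^esub> ?c) \<otimes>\<^bsub>i\<^esub> ?e) \<otimes>\<^bsub>j\<^esub> ((?b \<otimes>\<^bsub>i\<^esub> ?d) \<otimes>\<^bsub>i\<^esub> ?f))"
    by (intro red_comp[OF red_tensor[OF eta red_id] eta] wf ij)
  moreover have "is_redn (Mon n)
     ((Ident (?a \<otimes>\<^bsub>j\<^esub> ?b) \<^bold>\<otimes>\<^bsub>i\<^esub> eta i j ?c ?d ?e ?f) \<cdot> eta i j ?a ?b (?c \<otimes>\<^bsub>i\<^esub> ?e) (?d \<otimes>\<^bsub>i\<^esub> ?f))
     (((?a \<otimes>\<^bsub>j\<^esub> ?b) \<otimes>\<^bsub>i\<^esub> (?c \<otimes>\<^bsub>j\<^esub> ?d)) \<otimes>\<^bsub>i\<^esub> (?e \<otimes>\<^bsub>j\<^esub> ?f))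
     (((?a \<otimes>\<^bsub>i\<^esub> ?c) \<otimes>\<^bsub>i\<^esub> ?e) \<otimes>\<^bsub>j\<^esub> ((?b \<otimes>\<^bsub>i\<^esub> ?d) \<otimes>\<^bsub>i\<^esub> ?f))"
    by (intro red_conv[OF red_comp[OF red_tensor[OF red_id eta] eta]] te_tensor te_assoc wf ij)
  moreover have "is_redn (Mon n)
     (eta i j (?a \<otimes>\<^bsub>j\<^esub> ?b) ?c (?d \<otimes>\<^bsub>j\<^esub> ?e) ?f \<cdot> (eta i j ?a ?b ?d ?e \<^bold>\<otimes>\<^bsub>j\<^esub> Ident (?c \<otimes>\<^bsub>i\<^esub> ?f)))
     (((?a \<otimes>\<^bsub>j\<^esub> ?b) \<otimes>\<^bsub>j\<^esub> ?c) \<otimes>\<^bsub>i\<^esub> ((?d \<otimes>\<^bsub>j\<^esub> ?e) \<otimes>\<^bsub>j\<^esub> ?f))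
     (((?a \<otimes>\<^bsub>i\<^esub> ?d) \<otimes>\<^bsub>j\<^esub> (?b \<otimes>\<^bsub>i\<^esub> ?e)) \<otimes>\<^bsub>j\<^esub> (?c \<otimes>\<^bsub>i\<^esub> ?f))"
    by (intro red_comp[OF eta red_tensor[OF eta red_id]] wf ij)
  moreover have "is_redn (Mon n)
     (eta i j ?a (?b \<otimes>\<^bsub>j\<^esub> ?c) ?d (?e \<otimes>\<^bsub>j\<^esub> ?f) \<cdot> (Ident (?a \<otimes>\<^bsub>i\<^esub> ?d) \<^bold>\<otimes>\<^bsub>j\<^esub> eta i j ?b ?c ?e ?f))
     (((?a \<otimes>\<^bsub>j\<^esub> ?b) \<otimes>\<^bsub>j\<^esub> ?c) \<otimes>\<^bsub>i\<^esub> ((?d \<otimes>\<^bsub>j\<^esub> ?e) \<otimes>\<^bsub>j\<^esub> ?f))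
     (((?a \<otimes>\<^bsub>i\<^esub> ?d) \<otimes>\<^bsub>j\<^esub> (?b \<otimes>\<^bsub>i\<^esub> ?e)) \<otimes>\<^bsub>j\<^esub> (?c \<otimes>\<^bsub>i\<^esub> ?f))"
    by (intro red_conv[OF red_comp[OF eta red_tensor[OF red_id eta]]] te_tensor te_assoc wf ij)
  ultimately show ?thesis
    using assms(4) unfolding assoc_eqs_def Let_def by blast
qed

lemma hexagon_eqs_parallel:
  assumes "1 \<le> i" "i < j" "j < k" "k \<le> n" "(\<phi>, \<psi>) \<in> hexagon_eqs i j k"
  shows "\<exists>s t. is_redn (Mon n) \<phi> s t \<and> is_redn (Mon n) \<psi> s t"
proof -
  let ?a = "Var 0 :: mon_trm" and ?b = "Var 1 :: mon_trm" and ?c = "Var 2 :: mon_trm"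
    and ?d = "Var 3 :: mon_trm" and ?e = "Var 4 :: mon_trm" and ?f = "Var 5 :: mon_trm"
    and ?g = "Var 6 :: mon_trm" and ?h = "Var 7 :: mon_trm"
  have ijk: "i \<in> {1..n}" "j \<in> {1..n}" "k \<in> {1..n}" "1 \<le> j" "j \<le> n" "i < k" using assms by auto
  note wf = wf_tensor wf_unit wf_Var
  note eij = red_eta[OF assms(1,2) ijk(5)]
    and eik = red_eta[OF assms(1) ijk(6) assms(4)] and ejk = red_eta[OF ijk(4) assms(3,4)]
  have "is_redn (Mon n)
     ((eta j k ?a ?b ?c ?d \<^bold>\<otimes>\<^bsub>i\<^esub> eta j k ?e ?f ?g ?h)
         \<cdot> eta i k (?a \<otimes>\<^bsub>j\<^esub> ?c) (?b \<otimes>\<^bsub>j\<^esub> ?d) (?e \<otimes>\<^bsub>j\<^esub> ?g) (?f \<otimes>\<^bsub>j\<^esub> ?h)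
         \<cdot> (eta i j ?a ?c ?e ?g \<^bold>\<otimes>\<^bsub>k\<^esub> eta i j ?b ?d ?f ?h))
     (((?a \<otimes>\<^bsub>k\<^esub> ?b) \<otimes>\<^bsub>j\<^esub> (?c \<otimes>\<^bsub>k\<^esub> ?d)) \<otimes>\<^bsub>i\<^esub> ((?e \<otimes>\<^bsub>k\<^esub> ?f) \<otimes>\<^bsub>j\<^esub> (?g \<otimes>\<^bsub>k\<^esub> ?h)))
     (((?a \<otimes>\<^bsub>i\<^esub> ?e) \<otimes>\<^bsub>j\<^esub> (?c \<otimes>\<^bsub>i\<^esub> ?g)) \<otimes>\<^bsub>k\<^esub> ((?b \<otimes>\<^bsub>i\<^esub> ?f) \<otimes>\<^bsub>j\<^esub> (?d \<otimes>\<^bsub>i\<^esub> ?h)))"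
    by (intro red_comp[OF red_tensor[OF ejk ejk] red_comp[OF eik red_tensor[OF eij eij]]] wf ijk)
  moreover have "is_redn (Mon n)
     (eta i j (?a \<otimes>\<^bsub>k\<^esub> ?b) (?c \<otimes>\<^bsub>k\<^esub> ?d) (?e \<otimes>\<^bsub>k\<^esub> ?f) (?g \<otimes>\<^bsub>k\<^esub> ?h)
         \<cdot> (eta i k ?a ?b ?e ?f \<^bold>\<otimes>\<^bsub>j\<^esub> eta i k ?c ?d ?g ?h)
         \<cdot> eta j k (?a \<otimes>\<^bsub>i\<^esub> ?e) (?b \<otimes>\<^bsub>i\<^esub> ?f) (?c \<otimes>\<^bsub>i\<^esub> ?g) (?d \<otimes>\<^bsub>i\<^esub> ?h))
     (((?a \<otimes>\<^bsub>k\<^esub> ?b) \<otimes>\<^bsub>j\<^esub> (?c \<otimes>\<^bsub>k\<^esub> ?d)) \<otimes>\<^bsub>i\<^esub> ((?e \<otimes>\<^bsub>k\<^esub> ?f) \<otimes>\<^bsub>j\<^esub> (?g \<otimes>\<^bsub>k\<^esub> ?h)))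
     (((?a \<otimes>\<^bsub>i\<^esub> ?e) \<otimes>\<^bsub>j\<^esub> (?c \<otimes>\<^bsub>i\<^esub> ?g)) \<otimes>\<^bsub>k\<^esub> ((?b \<otimes>\<^bsub>i\<^esub> ?f) \<otimes>\<^bsub>j\<^esub> (?d \<otimes>\<^bsub>i\<^esub> ?h)))"
    by (intro red_comp[OF eij red_comp[OF red_tensor[OF eik eik] ejk]] wf ijk)
  ultimately show ?thesis
    using assms(5) unfolding hexagon_eqs_def Let_def by blast
qed

lemma is_two_theory_Mon: "is_two_theory (Mon n)"
proof -
  have "s \<in> wf_terms (Mon n) \<and> t \<in> wf_terms (Mon n)" if "(s, t) \<in> term_eqs (Mon n)" for s t
    using that by (auto simp: Mon_def[of n, THEN arg_cong[of _ _ term_eqs]] mon_term_eqs_def Let_def intro!: wf_mon)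
  moreover have "rule_src (Mon n) r \<in> wf_terms (Mon n) \<and> rule_tgt (Mon n) r \<in> wf_terms (Mon n) \<and>
        set (vars (rule_src (Mon n) r)) \<subseteq> {..<rule_arity (Mon n) r} \<and>
        set (vars (rule_tgt (Mon n) r)) \<subseteq> {..<rule_arity (Mon n) r}" if "r \<in> rules (Mon n)" for r
  proof -
    obtain i j where r: "r = (i, j)" "i \<in> {1..n}" "j \<in> {1..n}"
      using \<open>r \<in> rules (Mon n)\<close> by (auto simp: Mon_def)
    have eqs: "rule_src (Mon n) r = (Var 0 \<otimes>\<^bsub>j\<^esub> Var 1) \<otimes>\<^bsub>i\<^esub> (Var 2 \<otimes>\<^bsub>j\<^esub> Var 3)"
      "rule_tgt (Mon n) r = (Var 0 \<otimes>\<^bsub>i\<^esub> Var 2) \<otimes>\<^bsub>j\<^esub> (Var 1 \<otimes>\<^bsub>i\<^esub> Var 3)" "rule_arity (Mon n) r = 4"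
      by (simp_all add: Mon_def r(1))
    show ?thesis
      unfolding eqs using r by (auto intro!: wf_mon)
  qed
  moreover have "\<exists>s t. is_redn (Mon n) \<phi> s t \<and> is_redn (Mon n) \<psi> s t"
    if mem: "(\<phi>, \<psi>) \<in> redn_eqs (Mon n)" for \<phi> \<psi>
  proof -
    consider i j where "1 \<le> i" "i < j" "j \<le> n" "(\<phi>, \<psi>) \<in> unit_eqs i j"
      | i j where "1 \<le> i" "i < j" "j \<le> n" "(\<phi>, \<psi>) \<in> assoc_eqs i j"
      | i j k where "1 \<le> i" "i < j" "j < k" "k \<le> n" "(\<phi>, \<psi>) \<in> hexagon_eqs i j k"
      using mem by (auto simp: Mon_def)
    then show ?thesis
      using unit_eqs_parallel assoc_eqs_parallel hexagon_eqs_parallel by cases blast+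
  qed
  ultimately show ?thesis
    unfolding is_two_theory_def by blast
qed

end

theory Submission
  imports Defs
begin

text \<open>
  Interpret terms and reductions in an arbitrary strict \<open>n\<close>-fold monoidal category. If
  \<open>a = a\<^sub>1 \<otimes>\<^sub>i a\<^sub>2\<close> has no repeated variables and \<open>f : a \<rightarrow> b\<close>, then replacing the variables of \<open>a\<^sub>2\<close>
  (respectively \<open>a\<^sub>1\<close>) by the unit gives restrictions \<open>f\<^sub>1 : a\<^sub>1 \<rightarrow> b\<^sub>1\<close> and \<open>f\<^sub>2 : a\<^sub>2 \<rightarrow> b\<^sub>2\<close>, and there is a
  canonical \<open>\<xi>\<^sub>b : b\<^sub>1 \<otimes>\<^sub>i b\<^sub>2 \<rightarrow> b\<close>, built from the interchanges \<open>\<eta>\<^sup>i\<^sup>j\<close> by recursion on \<open>b\<close>. The unit,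
  associativity and hexagon equations say exactly that \<open>\<xi>\<close> is well defined and natural in \<open>b\<close>; since
  \<open>\<xi>\<^sub>a = 1\<close>, naturality reads \<open>f = (f\<^sub>1 \<otimes>\<^sub>i f\<^sub>2) \<cdot> \<xi>\<^sub>b\<close>. So \<open>f\<close> is determined by \<open>b\<close> and by reductions of the
  smaller terms \<open>a\<^sub>1\<close> and \<open>a\<^sub>2\<close>. Apply this to the category of reductions modulo congruence.
\<close>

section \<open>Induction principles specialised to the signature and the rules of
  \<open>Mon\<close>\<close>

lemma Mon_simps [simp]:
  "syms (Mon n) = insert Unit (Tensor ` {1..n})" "arity (Mon n) = mon_arity"
  "rules (Mon n) = {(i, j). 1 \<le> i \<and> i < j \<and> j \<le> n}" "rule_arity (Mon n) r = 4"
  "rule_src (Mon n) (i, j) = (Var 0 \<otimes>\<^bsub>j\<^esub> Var 1) \<otimes>\<^bsub>i\<^esub> (Var 2 \<otimes>\<^bsub>j\<^esub> Var 3)"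
  "rule_tgt (Mon n) (i, j) = (Var 0 \<otimes>\<^bsub>i\<^esub> Var 2) \<otimes>\<^bsub>j\<^esub> (Var 1 \<otimes>\<^bsub>i\<^esub> Var 3)"
  by (simp_all add: Mon_def)

lemma length_4_conv: "length xs = 4 \<longleftrightarrow> (\<exists>a b c d. xs = [a, b, c, d])"
  by (auto simp: numeral_eq_Suc length_Suc_conv)

lemma length_2_conv: "length xs = 2 \<longleftrightarrow> (\<exists>a b. xs = [a, b])"
  by (auto simp: numeral_eq_Suc length_Suc_conv)

lemma all_less_2: "(\<forall>k<2. P k) \<longleftrightarrow> P 0 \<and> P (1::nat)"
  by (auto simp: numeral_eq_Suc less_Suc_eq)

lemma all_less_4: "(\<forall>k<4. P k) \<longleftrightarrow> P 0 \<and> P (1::nat) \<and> P 2 \<and> P 3"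
  by (auto simp: numeral_eq_Suc less_Suc_eq)

lemma wf_Mon_induct [consumes 1, case_names Var unit tensor]:
  assumes "t \<in> wf_terms (Mon n)"
    and "\<And>x. P (Var x)" and "P \<I>"
    and "\<And>i a b. \<lbrakk>i \<in> {1..n}; a \<in> wf_terms (Mon n); b \<in> wf_terms (Mon n); P a; P b\<rbrakk> \<Longrightarrow> P (a \<otimes>\<^bsub>i\<^esub> b)"
  shows "P t"
  using assms(1)
proof (induction rule: wf_terms.induct)
  case (wf_App f ts)
  then show ?case
    using assms(3,4) by (auto simp: length_2_conv)
qed (rule assms)

lemma term_eq_Mon_induct [consumes 1, case_names assoc unit_right unit_left refl sym trans cong]:
  assumes "term_eq (Mon n) s t"
    and "\<And>i a b c. \<lbrakk>i \<in> {1..n}; a \<in> wf_terms (Mon n); b \<in> wf_terms (Mon n); c \<in> wf_terms (Mon n)\<rbrakk>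
      \<Longrightarrow> P (a \<otimes>\<^bsub>i\<^esub> (b \<otimes>\<^bsub>i\<^esub> c)) ((a \<otimes>\<^bsub>i\<^esub> b) \<otimes>\<^bsub>i\<^esub> c)"
    and "\<And>i a. \<lbrakk>i \<in> {1..n}; a \<in> wf_terms (Mon n)\<rbrakk> \<Longrightarrow> P (a \<otimes>\<^bsub>i\<^esub> \<I>) a"
    and "\<And>i a. \<lbrakk>i \<in> {1..n}; a \<in> wf_terms (Mon n)\<rbrakk> \<Longrightarrow> P (\<I> \<otimes>\<^bsub>i\<^esub> a) a"
    and "\<And>a. a \<in> wf_terms (Mon n) \<Longrightarrow> P a a"
    and "\<And>a b. \<lbrakk>term_eq (Mon n) a b; P a b\<rbrakk> \<Longrightarrow> P b a"
    and "\<And>a b c. \<lbrakk>term_eq (Mon n) a b; P a b; term_eq (Mon n) b c; P b c\<rbrakk> \<Longrightarrow> P a c"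
    and "\<And>i a b a' b'. \<lbrakk>i \<in> {1..n}; term_eq (Mon n) a a'; P a a'; term_eq (Mon n) b b'; P b b'\<rbrakk>
      \<Longrightarrow> P (a \<otimes>\<^bsub>i\<^esub> b) (a' \<otimes>\<^bsub>i\<^esub> b')"
  shows "P s t"
  using assms(1)
proof (induction rule: term_eq.induct)
  case (te_ax s t \<sigma>)
  then show ?case
    using assms(2-4) by (auto simp: Mon_def mon_term_eqs_def Let_def)
next
  case (te_cong f ss ts)
  show ?case
  proof (cases f)
    case (Tensor i)
    then show ?thesis
      using te_cong assms(8) by (auto simp: length_2_conv all_less_2)
  next
    case Unit
    then show ?thesis
      using te_cong assms(5) wf_unit by auto
  qed
qed (use assms in blast)+

lemma is_redn_Mon_induct [consumes 1, case_names ident unit tensor rule comp conv]: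
  assumes "is_redn (Mon n) f s t"
    and "\<And>s. s \<in> wf_terms (Mon n) \<Longrightarrow> P (Ident s) s s"
    and "P (FunR Unit []) \<I> \<I>"
    and "\<And>i f g s s' t t'. \<lbrakk>i \<in> {1..n}; is_redn (Mon n) f s t; P f s t; is_redn (Mon n) g s' t'; P g s' t'\<rbrakk>
      \<Longrightarrow> P (f \<^bold>\<otimes>\<^bsub>i\<^esub> g) (s \<otimes>\<^bsub>i\<^esub> s') (t \<otimes>\<^bsub>i\<^esub> t')"
    and "\<And>i j f g h k a b c d a' b' c' d'. \<lbrakk>1 \<le> i; i < j; j \<le> n;
        is_redn (Mon n) f a a'; P f a a'; is_redn (Mon n) g b b'; P g b b';
        is_redn (Mon n) h c c'; P h c c'; is_redn (Mon n) k d d'; P k d d'\<rbrakk>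
      \<Longrightarrow> P (RuleR (i, j) [f, g, h, k])
        ((a \<otimes>\<^bsub>j\<^esub> b) \<otimes>\<^bsub>i\<^esub> (c \<otimes>\<^bsub>j\<^esub> d)) ((a' \<otimes>\<^bsub>i\<^esub> c') \<otimes>\<^bsub>j\<^esub> (b' \<otimes>\<^bsub>i\<^esub> d'))"
    and "\<And>f g s t u. \<lbrakk>is_redn (Mon n) f s t; P f s t; is_redn (Mon n) g t u; P g t u\<rbrakk> \<Longrightarrow> P (f \<cdot> g) s u"
    and "\<And>f s t s' t'. \<lbrakk>is_redn (Mon n) f s t; P f s t; term_eq (Mon n) s s'; term_eq (Mon n) t t'\<rbrakk>
      \<Longrightarrow> P f s' t'"
  shows "P f s t"
  using assms(1)
proof (induction rule: is_redn.induct)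
  case (red_fun f \<phi>s ss ts)
  show ?case
  proof (cases f)
    case (Tensor i)
    then show ?thesis
      using red_fun assms(4) by (auto simp: length_2_conv all_less_2)
  next
    case Unit
    then show ?thesis
      using red_fun assms(3) by auto
  qed
next
  case (red_rule r \<phi>s ss ts)
  obtain i j where r: "r = (i, j)" by (cases r)
  show ?case
    using red_rule assms(5)[of i j] unfolding r by (auto simp: length_4_conv all_less_4)
next
  case red_comp
  then show ?case by (blast intro: assms(6))
next
  case red_conv
  then show ?case by (blast intro: assms(7))
qed (rule assms(2))

section \<open>Strict n-fold monoidal categories\<close>

text \<open>
  Single-sorted: an object is identified with its identity arrow, so \<open>ten\<close> acts on objects and
  arrows alike, and the arguments of \<open>ic\<close> are objects.
\<close>

locale strict_nfold_monoidal =
  fixes n :: nat and arr :: "'m \<Rightarrow> bool" and src tgt :: "'m \<Rightarrow> 'm"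
    and comp :: "'m \<Rightarrow> 'm \<Rightarrow> 'm"  (infixr "\<bullet>" 60)
    and ten :: "nat \<Rightarrow> 'm \<Rightarrow> 'm \<Rightarrow> 'm" and U :: 'm
    and ic :: "nat \<Rightarrow> nat \<Rightarrow> 'm \<Rightarrow> 'm \<Rightarrow> 'm \<Rightarrow> 'm \<Rightarrow> 'm"
    and ide :: "'m \<Rightarrow> bool"
  assumes ide_iff: "ide a \<longleftrightarrow> arr a \<and> src a = a"
    and src [simp]: "arr f \<Longrightarrow> arr (src f)" "arr f \<Longrightarrow> src (src f) = src f" "arr f \<Longrightarrow> tgt (src f) = src f"
    and tgt [simp]: "arr f \<Longrightarrow> arr (tgt f)" "arr f \<Longrightarrow> src (tgt f) = tgt f" "arr f \<Longrightarrow> tgt (tgt f) = tgt f"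
    and comp_in [simp]: "\<lbrakk>arr f; arr g; tgt f = src g\<rbrakk> \<Longrightarrow> arr (f \<bullet> g)"
      "\<lbrakk>arr f; arr g; tgt f = src g\<rbrakk> \<Longrightarrow> src (f \<bullet> g) = src f"
      "\<lbrakk>arr f; arr g; tgt f = src g\<rbrakk> \<Longrightarrow> tgt (f \<bullet> g) = tgt g"
    and comp_assoc: "\<lbrakk>arr f; arr g; arr h; tgt f = src g; tgt g = src h\<rbrakk> \<Longrightarrow> (f \<bullet> g) \<bullet> h = f \<bullet> (g \<bullet> h)"
    and src_comp [simp]: "arr f \<Longrightarrow> src f \<bullet> f = f"
    and comp_tgt [simp]: "arr f \<Longrightarrow> f \<bullet> tgt f = f"
    and ten_in [simp]: "\<lbrakk>i \<in> {1..n}; arr f; arr g\<rbrakk> \<Longrightarrow> arr (ten i f g)"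
      "\<lbrakk>i \<in> {1..n}; arr f; arr g\<rbrakk> \<Longrightarrow> src (ten i f g) = ten i (src f) (src g)"
      "\<lbrakk>i \<in> {1..n}; arr f; arr g\<rbrakk> \<Longrightarrow> tgt (ten i f g) = ten i (tgt f) (tgt g)"
    and ten_assoc: "\<lbrakk>i \<in> {1..n}; arr f; arr g; arr h\<rbrakk> \<Longrightarrow> ten i (ten i f g) h = ten i f (ten i g h)"
    and ten_comp: "\<lbrakk>i \<in> {1..n}; arr f; arr g; arr f'; arr g'; tgt f = src g; tgt f' = src g'\<rbrakk>
      \<Longrightarrow> ten i (f \<bullet> g) (f' \<bullet> g') = ten i f f' \<bullet> ten i g g'"
    and U [simp]: "arr U" "src U = U" "tgt U = U"
    and ten_U [simp]: "\<lbrakk>i \<in> {1..n}; arr f\<rbrakk> \<Longrightarrow> ten i f U = f"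
    and U_ten [simp]: "\<lbrakk>i \<in> {1..n}; arr f\<rbrakk> \<Longrightarrow> ten i U f = f"
    and ic_in [simp]: "\<lbrakk>1 \<le> i; i < j; j \<le> n; ide a; ide b; ide c; ide d\<rbrakk> \<Longrightarrow> arr (ic i j a b c d)"
      "\<lbrakk>1 \<le> i; i < j; j \<le> n; ide a; ide b; ide c; ide d\<rbrakk>
        \<Longrightarrow> src (ic i j a b c d) = ten i (ten j a b) (ten j c d)"
      "\<lbrakk>1 \<le> i; i < j; j \<le> n; ide a; ide b; ide c; ide d\<rbrakk>
        \<Longrightarrow> tgt (ic i j a b c d) = ten j (ten i a c) (ten i b d)"
    and ic_natural: "\<lbrakk>1 \<le> i; i < j; j \<le> n; arr f; arr g; arr f'; arr g'\<rbrakk>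
      \<Longrightarrow> ten i (ten j f g) (ten j f' g') \<bullet> ic i j (tgt f) (tgt g) (tgt f') (tgt g') =
          ic i j (src f) (src g) (src f') (src g') \<bullet> ten j (ten i f f') (ten i g g')"
    and ic_unit: "\<lbrakk>1 \<le> i; i < j; j \<le> n; ide a; ide b\<rbrakk> \<Longrightarrow> ic i j a b U U = ten j a b"
      "\<lbrakk>1 \<le> i; i < j; j \<le> n; ide a; ide b\<rbrakk> \<Longrightarrow> ic i j U U a b = ten j a b"
      "\<lbrakk>1 \<le> i; i < j; j \<le> n; ide a; ide b\<rbrakk> \<Longrightarrow> ic i j a U b U = ten i a b"
      "\<lbrakk>1 \<le> i; i < j; j \<le> n; ide a; ide b\<rbrakk> \<Longrightarrow> ic i j U a U b = ten i a b"
    and ic_internal: "\<lbrakk>1 \<le> i; i < j; j \<le> n; ide a; ide b; ide c; ide d; ide e; ide f\<rbrakk>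
      \<Longrightarrow> ten i (ic i j a b c d) (ten j e f) \<bullet> ic i j (ten i a c) (ten i b d) e f =
          ten i (ten j a b) (ic i j c d e f) \<bullet> ic i j a b (ten i c e) (ten i d f)"
    and ic_external: "\<lbrakk>1 \<le> i; i < j; j \<le> n; ide a; ide b; ide c; ide d; ide e; ide f\<rbrakk>
      \<Longrightarrow> ic i j (ten j a b) c (ten j d e) f \<bullet> ten j (ic i j a b d e) (ten i c f) =
          ic i j a (ten j b c) d (ten j e f) \<bullet> ten j (ten i a d) (ic i j b c e f)"
    and ic_hexagon: "\<lbrakk>1 \<le> i; i < j; j < k; k \<le> n;
        ide a; ide b; ide c; ide d; ide e; ide f; ide g; ide h\<rbrakk>
      \<Longrightarrow> ten i (ic j k a b c d) (ic j k e f g h)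
            \<bullet> ic i k (ten j a c) (ten j b d) (ten j e g) (ten j f h)
            \<bullet> ten k (ic i j a c e g) (ic i j b d f h) =
          ic i j (ten k a b) (ten k c d) (ten k e f) (ten k g h)
            \<bullet> ten j (ic i k a b e f) (ic i k c d g h)
            \<bullet> ic j k (ten i a e) (ten i b f) (ten i c g) (ten i d h)"
begin

lemma ideI: "arr a \<Longrightarrow> src a = a \<Longrightarrow> ide a"
  by (simp add: ide_iff)

lemma ide_simps [simp]:
  "ide a \<Longrightarrow> arr a" "ide a \<Longrightarrow> src a = a" "ide a \<Longrightarrow> tgt a = a"
  unfolding ide_iff using src(3)[of a] by auto

lemma ide_intros [simp]:
  "ide U" "\<lbrakk>i \<in> {1..n}; ide a; ide b\<rbrakk> \<Longrightarrow> ide (ten i a b)" "arr f \<Longrightarrow> ide (src f)" "arr f \<Longrightarrow> ide (tgt f)"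
  by (auto intro!: ideI)

lemma ide_comp: "ide a \<Longrightarrow> arr f \<Longrightarrow> src f = a \<Longrightarrow> a \<bullet> f = f"
  and comp_ide: "ide a \<Longrightarrow> arr f \<Longrightarrow> tgt f = a \<Longrightarrow> f \<bullet> a = f"
  using src_comp comp_tgt by blast+

section \<open>Evaluation of terms and reductions at a valuation by objects\<close>

primrec sym_op :: "mon_sym \<Rightarrow> 'm list \<Rightarrow> 'm" where
  "sym_op (Tensor i) as = ten i (as ! 0) (as ! 1)"
| "sym_op Unit as = U"

primrec tm :: "(nat \<Rightarrow> 'm) \<Rightarrow> mon_trm \<Rightarrow> 'm" where
  "tm v (Var x) = v x"
| "tm v (App f ts) = sym_op f (map (tm v) ts)"

text \<open>Only objects are admitted in \<open>ic\<close>; its extension to arrows is one side of the naturality square.\<close>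

definition rule_op :: "nat \<times> nat \<Rightarrow> 'm list \<Rightarrow> 'm" where
  "rule_op r fs = ten (fst r) (ten (snd r) (fs ! 0) (fs ! 1)) (ten (snd r) (fs ! 2) (fs ! 3))
     \<bullet> ic (fst r) (snd r) (tgt (fs ! 0)) (tgt (fs ! 1)) (tgt (fs ! 2)) (tgt (fs ! 3))"

primrec ev :: "(nat \<Rightarrow> 'm) \<Rightarrow> mon_redn \<Rightarrow> 'm" where
  "ev v (Ident s) = tm v s"
| "ev v (FunR f \<phi>s) = sym_op f (map (ev v) \<phi>s)"
| "ev v (RuleR r \<phi>s) = rule_op r (map (ev v) \<phi>s)"
| "ev v (\<phi> \<cdot> \<psi>) = ev v \<phi> \<bullet> ev v \<psi>"

lemma ev_tsubst_redn: "ev v (tsubst_redn (\<lambda>x. Ident (\<sigma> x)) t) = tm (\<lambda>x. tm v (\<sigma> x)) t"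
  by (induction t) (auto simp: comp_def intro!: arg_cong[of _ _ "sym_op _"])

text \<open>Substitution lemma for \<open>ev\<close>. It later turns evaluation at a valuation that
  sends some variables to \<open>U\<close> into evaluation of a restricted reduction, to which an
  induction hypothesis applies.\<close>

lemma ev_inst_redn: "ev v (inst_redn \<sigma> \<phi>) = ev (\<lambda>x. tm v (\<sigma> x)) \<phi>"
  by (induction \<phi>)
    (auto simp: ev_tsubst_redn comp_def intro!: arg_cong[of _ _ "sym_op _"] arg_cong[of _ _ "rule_op _"])

lemma ide_tm:
  assumes "\<And>x. ide (v x)"
  shows "t \<in> wf_terms (Mon n) \<Longrightarrow> ide (tm v t)"
  by (induction rule: wf_Mon_induct) (auto simp: assms)

lemma tm_term_eq:
  assumes "\<And>x. ide (v x)"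
  shows "term_eq (Mon n) s t \<Longrightarrow> tm v s = tm v t"
proof (induction rule: term_eq_Mon_induct)
  case (assoc i a b c)
  then show ?case using ide_tm[OF assms] by (simp add: ten_assoc)
qed (use ide_tm[OF assms] in auto)

lemma ev_in:
  assumes "\<And>x. ide (v x)"
  shows "is_redn (Mon n) f s t \<Longrightarrow> arr (ev v f) \<and> src (ev v f) = tm v s \<and> tgt (ev v f) = tm v t"
proof (induction rule: is_redn_Mon_induct)
  case (rule i j f g h k a b c d a' b' c' d')
  then have "ide (tm v a')" "ide (tm v b')" "ide (tm v c')" "ide (tm v d')"
    using rule.hyps(4-7)[THEN is_redn_wf[OF is_two_theory_Mon]] by (simp_all add: ide_tm assms)
  then show ?case using rule by (auto simp: rule_op_def numeral_eq_Suc)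
next
  case (conv f s t s' t')
  then show ?case using tm_term_eq[OF assms] by simp
qed (use ide_tm[OF assms] in auto)

text \<open>Both sides of each term equation contain the same variables with the same
  multiplicities.\<close>

lemma term_eq_length_filter: "term_eq (Mon n) s t \<Longrightarrow> length (filter P (vars s)) = length (filter P (vars t))"
  by (induction rule: term_eq_Mon_induct) auto

lemma tm_eq_U:
  "t \<in> wf_terms (Mon n) \<Longrightarrow> length (filter (\<lambda>x. v x \<noteq> U) (vars t)) = 0 \<Longrightarrow> tm v t = U"
  by (induction rule: wf_Mon_induct) (auto split: if_splits)

text \<open>With at most one occurrence of a variable whose value differs from \<open>U\<close>,
  every interchange has at least three arguments equal to \<open>U\<close> and is an identity by the
  unit laws. The preserved count is part of the claim because a composite needs the bound again at
  the intermediate term.\<close>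

lemma ev_small:
  assumes v: "\<And>x. ide (v x)"
  shows "is_redn (Mon n) f s t \<Longrightarrow> length (filter (\<lambda>x. v x \<noteq> U) (vars s)) \<le> 1 \<Longrightarrow>
    ev v f = tm v s \<and> tm v t = tm v s \<and> 
      length (filter (\<lambda>x. v x \<noteq> U) (vars t)) = length (filter (\<lambda>x. v x \<noteq> U) (vars s))"
proof (induction rule: is_redn_Mon_induct)
  case (tensor i f g s s' t t')
  then show ?case by simp
next
  case (rule i j f g h k a b c d a' b' c' d')
  let ?l = "\<lambda>t. length (filter (\<lambda>x. v x \<noteq> U) (vars t))"
  note wf = rule.hyps(4-7)[THEN is_redn_wf[OF is_two_theory_Mon]]
  have l: "?l a + ?l b + ?l c + ?l d \<le> 1" using rule.prems by simp
  have ev: "ev v f = tm v a" "ev v g = tm v b" "ev v h = tm v c" "ev v k = tm v d"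
    "tm v a' = tm v a" "tm v b' = tm v b" "tm v c' = tm v c" "tm v d' = tm v d"
    using l rule by auto
  have l': "?l ((a' \<otimes>\<^bsub>i\<^esub> c') \<otimes>\<^bsub>j\<^esub> (b' \<otimes>\<^bsub>i\<^esub> d')) = ?l ((a \<otimes>\<^bsub>j\<^esub> b) \<otimes>\<^bsub>i\<^esub> (c \<otimes>\<^bsub>j\<^esub> d))"
    using rule l by simp
  have ide: "ide (tm v a)" "ide (tm v b)" "ide (tm v c)" "ide (tm v d)"
    using wf ide_tm[OF v] by auto
  have U: "?l t = 0 \<Longrightarrow> tm v t = U" if "t \<in> {a, b, c, d}" for t
    using that wf tm_eq_U by blast
  \<comment> \<open>The four counts add up to at most one, so at least three of them vanish.\<close>
  consider "tm v a = U" "tm v b = U" "tm v c = U" | "tm v a = U" "tm v b = U" "tm v d = U"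
    | "tm v a = U" "tm v c = U" "tm v d = U" | "tm v b = U" "tm v c = U" "tm v d = U"
  proof -
    have "?l a = 0 \<and> ?l b = 0 \<and> ?l c = 0 \<or> ?l a = 0 \<and> ?l b = 0 \<and> ?l d = 0
        \<or> ?l a = 0 \<and> ?l c = 0 \<and> ?l d = 0 \<or> ?l b = 0 \<and> ?l c = 0 \<and> ?l d = 0"
      using l by linarith
    then show ?thesis using U that by blast
  qed
  then have "ten i (ten j (tm v a) (tm v b)) (ten j (tm v c) (tm v d))
        \<bullet> ic i j (tm v a) (tm v b) (tm v c) (tm v d) =
      ten i (ten j (tm v a) (tm v b)) (ten j (tm v c) (tm v d)) \<and>
      ten j (ten i (tm v a) (tm v c)) (ten i (tm v b) (tm v d)) =
      ten i (ten j (tm v a) (tm v b)) (ten j (tm v c) (tm v d))"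
    using ide rule.hyps(1-3) by cases (simp_all add: ic_unit ide_comp)
  then show ?case
    using l' ide by (simp add: rule_op_def numeral_eq_Suc ev)
next
  case (conv f s t s' t')
  have "length (filter (\<lambda>x. v x \<noteq> U) (vars s)) = length (filter (\<lambda>x. v x \<noteq> U) (vars s'))"
    "length (filter (\<lambda>x. v x \<noteq> U) (vars t)) = length (filter (\<lambda>x. v x \<noteq> U) (vars t'))"
    "tm v s = tm v s'" "tm v t = tm v t'"
    using conv.hyps term_eq_length_filter tm_term_eq[OF v] by auto
  then show ?case using conv.IH conv.prems by simp
next
  case (comp f g s t u)
  then show ?case using ide_tm[OF v] is_redn_wf[OF is_two_theory_Mon comp(1)] by (simp add: ide_comp)
qed (use ide_tm[OF v] in auto)

end

section \<open>Splitting the variables into two parts\<close>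

text \<open>In the application \<open>p\<close> is the index of the outermost product of the source,
  and \<open>S\<close> contains the variables of its left factor and none of its right
  factor.\<close>

locale splitting = strict_nfold_monoidal +
  fixes p :: nat and S :: "nat set" and v :: "nat \<Rightarrow> 'a"
  assumes p: "p \<in> {1..n}" and ide_v: "ide (v x)"
begin

text \<open>Restriction changes the valuation and leaves the term alone, so both restrictions of
  \<open>t\<close> and the arrow \<open>xi t\<close> are defined by recursion over the same
  \<open>t\<close>.\<close>

definition v1 :: "nat \<Rightarrow> 'a" where "v1 x = (if x \<in> S then v x else U)"
definition v2 :: "nat \<Rightarrow> 'a" where "v2 x = (if x \<in> S then U else v x)"

text \<open>A term satisfies both \<open>in1\<close> and \<open>in2\<close> precisely when it has no
  variables; \<open>admissible\<close> detects unit factors in this way.\<close>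

definition in1 :: "mon_trm \<Rightarrow> bool" where "in1 t \<longleftrightarrow> set (vars t) \<subseteq> S"
definition in2 :: "mon_trm \<Rightarrow> bool" where "in2 t \<longleftrightarrow> (\<forall>x\<in>set (vars t). x \<notin> S)"

lemma in_simps [simp]:
  "in1 \<I>" "in2 \<I>" "in1 (a \<otimes>\<^bsub>j\<^esub> b) \<longleftrightarrow> in1 a \<and> in1 b" "in2 (a \<otimes>\<^bsub>j\<^esub> b) \<longleftrightarrow> in2 a \<and> in2 b"
  by (auto simp: in1_def in2_def)

text \<open>
  The condition on \<open>t\<close> under which there is a canonical arrow from \<open>t\<^sub>1 \<otimes>\<^sub>p t\<^sub>2\<close> to \<open>t\<close>: whenever \<open>x\<close> lies in
  \<open>S\<close> and \<open>y\<close> does not, \<open>t\<close> combines them as \<open>x \<otimes>\<^sub>j y\<close> with \<open>j \<ge> p\<close> or as \<open>y \<otimes>\<^sub>j x\<close> with \<open>j > p\<close>. For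
  \<open>j < p\<close> all variables of a \<open>\<otimes>\<^sub>j\<close>-product are therefore on one side, or one factor has none.
\<close>

primrec admissible :: "mon_trm \<Rightarrow> bool" where
  "admissible (Var x) \<longleftrightarrow> True"
| "admissible (App f ts) \<longleftrightarrow> (\<forall>b \<in> set (map admissible ts). b) \<and>
    (case f of Unit \<Rightarrow> True | Tensor j \<Rightarrow>
      p < j \<or> (j = p \<and> (in1 (ts ! 0) \<or> in2 (ts ! 1))) \<or>
      (j < p \<and> (in1 (ts ! 0) \<and> in1 (ts ! 1) \<or> in2 (ts ! 0) \<and> in2 (ts ! 1)
        \<or> in1 (ts ! 0) \<and> in2 (ts ! 0) \<or> in1 (ts ! 1) \<and> in2 (ts ! 1))))"

lemma admissible_simps [simp]:
  "admissible \<I>"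
  "admissible (a \<otimes>\<^bsub>j\<^esub> b) \<longleftrightarrow> admissible a \<and> admissible b \<and> (p < j \<or> j = p \<and> (in1 a \<or> in2 b) \<or>
     j < p \<and> (in1 a \<and> in1 b \<or> in2 a \<and> in2 b \<or> in1 a \<and> in2 a \<or> in1 b \<and> in2 b))"
  by auto

text \<open>
  For \<open>j \<le> p\<close> no interchange is needed: on admissible terms enough factors are the unit for
  \<open>(a\<^sub>1 \<otimes>\<^sub>j b\<^sub>1) \<otimes>\<^sub>p (a\<^sub>2 \<otimes>\<^sub>j b\<^sub>2)\<close> and \<open>(a\<^sub>1 \<otimes>\<^sub>p a\<^sub>2) \<otimes>\<^sub>j (b\<^sub>1 \<otimes>\<^sub>p b\<^sub>2)\<close> to coincide.
\<close>

primrec xi :: "mon_trm \<Rightarrow> 'a" where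
  "xi (Var x) = v x"
| "xi (App f ts) = (case f of Unit \<Rightarrow> U | Tensor j \<Rightarrow>
    if p < j then ic p j (tm v1 (ts ! 0)) (tm v1 (ts ! 1)) (tm v2 (ts ! 0)) (tm v2 (ts ! 1))
      \<bullet> ten j (map xi ts ! 0) (map xi ts ! 1)
    else ten j (map xi ts ! 0) (map xi ts ! 1))"

lemma xi_simps [simp]:
  "xi \<I> = U"
  "xi (a \<otimes>\<^bsub>j\<^esub> b) = (if p < j then ic p j (tm v1 a) (tm v1 b) (tm v2 a) (tm v2 b) \<bullet> ten j (xi a) (xi b)
     else ten j (xi a) (xi b))"
  by simp_all

declare admissible.simps(2) [simp del] xi.simps(2) [simp del]

section \<open>Endpoints of \<open>xi\<close> and its invariance under the term equations\<close>

lemma p_simps [simp]: "1 \<le> p" "p \<le> n" "0 < p" "Suc 0 \<le> p"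
  using p by auto

lemma ide_v12 [simp]: "ide (v x)" "ide (v1 x)" "ide (v2 x)"
  using ide_v by (auto simp: v1_def v2_def)

lemma ide_tm12 [simp]:
  assumes "t \<in> wf_terms (Mon n)"
  shows "ide (tm v t)" "ide (tm v1 t)" "ide (tm v2 t)"
  using assms by (auto intro: ide_tm)

lemma tm_in1: "t \<in> wf_terms (Mon n) \<Longrightarrow> in1 t \<Longrightarrow> tm v1 t = tm v t \<and> tm v2 t = U"
  by (induction rule: wf_Mon_induct) (auto simp: v1_def v2_def in1_def)

lemma tm_in2: "t \<in> wf_terms (Mon n) \<Longrightarrow> in2 t \<Longrightarrow> tm v2 t = tm v t \<and> tm v1 t = U"
  by (induction rule: wf_Mon_induct) (auto simp: v1_def v2_def in2_def)

lemma tm_in12: "t \<in> wf_terms (Mon n) \<Longrightarrow> in1 t \<Longrightarrow> in2 t \<Longrightarrow> tm v t = U"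
  using tm_in1 tm_in2 by metis

text \<open>When all variables lie on the first side, each interchange in \<open>xi t\<close> has
  the form \<open>ic p j x y U U\<close> and is an identity by the internal unit law;
  \<open>xi_in2\<close> is the mirror image.\<close>

lemma xi_in1: "t \<in> wf_terms (Mon n) \<Longrightarrow> in1 t \<Longrightarrow> xi t = tm v t"
  by (induction rule: wf_Mon_induct) (auto simp: tm_in1 ic_unit ide_comp)

lemma xi_in2: "t \<in> wf_terms (Mon n) \<Longrightarrow> in2 t \<Longrightarrow> xi t = tm v t"
  by (induction rule: wf_Mon_induct) (auto simp: tm_in2 ic_unit ide_comp)

lemma xi_in: "t \<in> wf_terms (Mon n) \<Longrightarrow> admissible t \<Longrightarrow>
    arr (xi t) \<and> src (xi t) = ten p (tm v1 t) (tm v2 t) \<and> tgt (xi t) = tm v t"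
proof (induction rule: wf_Mon_induct)
  case (Var x)
  then show ?case by (auto simp: v1_def v2_def)
next
  case (tensor j a b)
  \<comment> \<open>These are the ways in which a product is admissible. For \<open>j = p\<close>
    the one-sided factor lets associativity regroup the source; for \<open>j < p\<close> one side or
    one factor reduces to \<open>U\<close>.\<close>
  consider "p < j" | "j = p" "in1 a" | "j = p" "in2 b" | "j < p" "in1 a" "in1 b"
    | "j < p" "in2 a" "in2 b" | "j < p" "in1 a" "in2 a" | "j < p" "in1 b" "in2 b"
    using tensor.prems by auto
  then show ?case
    using tensor.hyps tensor.IH tensor.prems
    by cases (simp_all add: tm_in12 tm_in1 tm_in2 xi_in1 xi_in2 ten_assoc)
qed auto

lemma term_eq_in: "term_eq (Mon n) s t \<Longrightarrow> (in1 s \<longleftrightarrow> in1 t) \<and> (in2 s \<longleftrightarrow> in2 t)"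
  by (induction rule: term_eq_Mon_induct) auto

lemma term_eq_admissible: "term_eq (Mon n) s t \<Longrightarrow> admissible s \<longleftrightarrow> admissible t"
proof (induction rule: term_eq_Mon_induct)
  case (assoc j a b c)
  \<comment> \<open>Once the position of \<open>j\<close> relative to \<open>p\<close> is fixed, the
    claim is propositional in \<open>in1\<close> and \<open>in2\<close> of the three
    factors.\<close>
  then show ?case by (cases "j = p"; cases "p < j"; simp) argo+
qed (auto dest: term_eq_in)

text \<open>For \<open>p < j\<close> associativity of the product is matched by external
  associativity of the interchange, and the unit equations by the external unit law. For
  \<open>j\<close> at most \<open>p\<close> no interchange occurs and the laws of \<open>ten\<close>
  suffice.\<close>

lemma xi_term_eq: "term_eq (Mon n) s t \<Longrightarrow> admissible s \<Longrightarrow> xi s = xi t"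
proof (induction rule: term_eq_Mon_induct)
  case (assoc j a b c)
  have "admissible a" "admissible b" "admissible c" using assoc.prems by simp_all
  note xi = xi_in[OF assoc.hyps(2) this(1)] xi_in[OF assoc.hyps(3) this(2)] xi_in[OF assoc.hyps(4) this(3)]
  show ?case
  proof (cases "p < j")
    case True
    have j: "1 \<le> p" "p < j" "j \<le> n" "j \<in> {1..n}" using True assoc.hyps(1) by auto
    note [simp] = assoc.hyps xi
    let ?a1 = "tm v1 a" and ?a2 = "tm v2 a" and ?b1 = "tm v1 b" and ?b2 = "tm v2 b"
      and ?c1 = "tm v1 c" and ?c2 = "tm v2 c"
    let ?L = "ic p j ?a1 (ten j ?b1 ?c1) ?a2 (ten j ?b2 ?c2)" and ?L' = "ic p j ?b1 ?c1 ?b2 ?c2"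
      and ?R = "ic p j (ten j ?a1 ?b1) ?c1 (ten j ?a2 ?b2) ?c2" and ?R' = "ic p j ?a1 ?b1 ?a2 ?b2"
    \<comment> \<open>The source of \<open>xi a\<close> is inserted as an identity in front of it,
      so that \<open>ten_comp\<close> can separate the layer of interchanges from the layer of
      \<open>xi a\<close>, \<open>xi b\<close> and \<open>xi c\<close>.\<close>
    have "xi (a \<otimes>\<^bsub>j\<^esub> (b \<otimes>\<^bsub>j\<^esub> c)) = ?L \<bullet> ten j (ten p ?a1 ?a2 \<bullet> xi a) (?L' \<bullet> ten j (xi b) (xi c))"
      using j by (simp add: ide_comp)
    also have "\<dots> = (?L \<bullet> ten j (ten p ?a1 ?a2) ?L') \<bullet> ten j (xi a) (ten j (xi b) (xi c))"
      using j by (simp add: ten_comp comp_assoc)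
    also have "\<dots> = (?R \<bullet> ten j ?R' (ten p ?c1 ?c2)) \<bullet> ten j (ten j (xi a) (xi b)) (xi c)"
      using j by (simp add: ic_external ten_assoc)
    also have "\<dots> = ?R \<bullet> ten j (?R' \<bullet> ten j (xi a) (xi b)) (ten p ?c1 ?c2 \<bullet> xi c)"
      using j by (simp add: ten_comp comp_assoc ten_assoc)
    also have "\<dots> = xi ((a \<otimes>\<^bsub>j\<^esub> b) \<otimes>\<^bsub>j\<^esub> c)"
      using j by (simp add: ide_comp)
    finally show ?thesis .
  next
    case False
    then show ?thesis using assoc.hyps xi by (simp add: ten_assoc)
  qed
next
  case (unit_right j a)
  then show ?case using xi_in[of a] by (auto simp: ic_unit ide_comp)
next
  case (unit_left j a)
  then show ?case using xi_in[of a] by (auto simp: ic_unit ide_comp)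
next
  case (sym a b)
  then show ?case using term_eq_admissible by auto
next
  case (trans a b c)
  then show ?case using term_eq_admissible by auto
next
  case (cong j a b a' b')
  then have "tm v1 a = tm v1 a'" "tm v1 b = tm v1 b'" "tm v2 a = tm v2 a'" "tm v2 b = tm v2 b'"
    using tm_term_eq ide_v12 by blast+
  then show ?case using cong by auto
qed auto


section \<open>Naturality of \<open>xi\<close> with respect to reductions\<close>

lemma U_U [simp]: "U \<bullet> U = U"
  by (simp add: ide_comp)

text \<open>The naturality square for an arrow \<open>F\<close> with restrictions \<open>F1\<close>
  and \<open>F2\<close>, bundled with what an induction over reductions has to carry: endpoints, the
  form of the restrictions on one-sided terms, and admissibility of the target, without which
  squares could not be pasted.\<close>

definition natural :: "mon_trm \<Rightarrow> mon_trm \<Rightarrow> 'a \<Rightarrow> 'a \<Rightarrow> 'a \<Rightarrow> bool" where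
  "natural s t F1 F2 F \<longleftrightarrow> s \<in> wf_terms (Mon n) \<and> t \<in> wf_terms (Mon n) \<and>
    (arr F \<and> src F = tm v s \<and> tgt F = tm v t) \<and>
    (arr F1 \<and> src F1 = tm v1 s \<and> tgt F1 = tm v1 t) \<and>
    (arr F2 \<and> src F2 = tm v2 s \<and> tgt F2 = tm v2 t) \<and>
    (in1 s \<longleftrightarrow> in1 t) \<and> (in2 s \<longleftrightarrow> in2 t) \<and>
    (in1 s \<longrightarrow> F1 = F \<and> F2 = U) \<and> (in2 s \<longrightarrow> F1 = U \<and> F2 = F) \<and>
    (admissible s \<longrightarrow> admissible t \<and> ten p F1 F2 \<bullet> xi t = xi s \<bullet> F)"

lemma natural_ident: "s \<in> wf_terms (Mon n) \<Longrightarrow> natural s s (tm v1 s) (tm v2 s) (tm v s)"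
  using xi_in[of s] by (auto simp: natural_def ide_comp comp_ide tm_in1 tm_in2)

lemma natural_comp:
  assumes F: "natural s t F1 F2 F" and G: "natural t u G1 G2 G"
  shows "natural s u (F1 \<bullet> G1) (F2 \<bullet> G2) (F \<bullet> G)"
proof -
  have "ten p (F1 \<bullet> G1) (F2 \<bullet> G2) \<bullet> xi u = xi s \<bullet> (F \<bullet> G)" if "admissible s"
  proof -
    have "admissible t" "admissible u" using that F G by (auto simp: natural_def)
    note xi = xi_in[OF _ \<open>admissible s\<close>] xi_in[OF _ \<open>admissible t\<close>] xi_in[OF _ \<open>admissible u\<close>]
    note [simp] = F[unfolded natural_def] G[unfolded natural_def] xi
    have "ten p (F1 \<bullet> G1) (F2 \<bullet> G2) \<bullet> xi u = ten p F1 F2 \<bullet> (ten p G1 G2 \<bullet> xi u)"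
      by (simp add: ten_comp comp_assoc)
    also have "\<dots> = (ten p F1 F2 \<bullet> xi t) \<bullet> G"
      using \<open>admissible t\<close> G by (simp add: comp_assoc)
    also have "\<dots> = xi s \<bullet> (F \<bullet> G)"
      using \<open>admissible s\<close> F by (simp add: comp_assoc)
    finally show ?thesis .
  qed
  then show ?thesis
    using F G by (simp add: natural_def)
qed

lemma natural_conv:
  assumes F: "natural s t F1 F2 F" and s: "term_eq (Mon n) s s'" and t: "term_eq (Mon n) t t'"
  shows "natural s' t' F1 F2 F"
proof -
  have "tm w r = tm w r'" if "\<And>x. ide (w x)" "term_eq (Mon n) r r'" for w r r'
    using tm_term_eq that by blast
  then have "tm v s = tm v s'" "tm v1 s = tm v1 s'" "tm v2 s = tm v2 s'"
    "tm v t = tm v t'" "tm v1 t = tm v1 t'" "tm v2 t = tm v2 t'"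
    using s t by simp_all
  moreover have "s' \<in> wf_terms (Mon n)" "t' \<in> wf_terms (Mon n)"
    using term_eq_wf[OF is_two_theory_Mon] s t by blast+
  moreover have "admissible s' \<longrightarrow> admissible t' \<and> ten p F1 F2 \<bullet> xi t' = xi s' \<bullet> F"
  proof
    assume "admissible s'"
    then have ok: "admissible s" "admissible t" using F term_eq_admissible[OF s] by (simp_all add: natural_def)
    then show "admissible t' \<and> ten p F1 F2 \<bullet> xi t' = xi s' \<bullet> F"
      using F term_eq_admissible[OF t] by (simp add: natural_def flip: xi_term_eq[OF s] xi_term_eq[OF t])
  qed
  ultimately show ?thesis
    using F term_eq_in[OF s] term_eq_in[OF t] by (simp add: natural_def)
qed

text \<open>For \<open>p < j\<close> the square is naturality of the interchange followed by the
  squares of the factors. For \<open>j = p\<close> a one-sided factor permits rebracketing. For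
  \<open>j < p\<close> either everything is one-sided and \<open>xi\<close> is an identity, or one
  factor is \<open>U\<close> and the square of the other remains.\<close>

lemma natural_tensor:
  assumes j: "j \<in> {1..n}" and F: "natural a a' F1 F2 F" and G: "natural b b' G1 G2 G"
  shows "natural (a \<otimes>\<^bsub>j\<^esub> b) (a' \<otimes>\<^bsub>j\<^esub> b') (ten j F1 G1) (ten j F2 G2) (ten j F G)"
proof -
  note wf = F[unfolded natural_def] G[unfolded natural_def]
  have eq: "ten p (ten j F1 G1) (ten j F2 G2) \<bullet> xi (a' \<otimes>\<^bsub>j\<^esub> b') = xi (a \<otimes>\<^bsub>j\<^esub> b) \<bullet> ten j F G"
    if ok: "admissible (a \<otimes>\<^bsub>j\<^esub> b)"
  proof -
    have ok': "admissible a" "admissible b" "admissible a'" "admissible b'" using ok wf by simp_all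
    have nat: "ten p F1 F2 \<bullet> xi a' = xi a \<bullet> F" "ten p G1 G2 \<bullet> xi b' = xi b \<bullet> G"
      using ok' wf by simp_all
    have ty: "a \<in> wf_terms (Mon n)" "b \<in> wf_terms (Mon n)" "a' \<in> wf_terms (Mon n)" "b' \<in> wf_terms (Mon n)"
      "arr F" "arr G" "arr F1" "arr G1" "arr F2" "arr G2"
      "src F = tm v a" "tgt F = tm v a'" "src F1 = tm v1 a" "tgt F1 = tm v1 a'" "src F2 = tm v2 a" "tgt F2 = tm v2 a'"
      "src G = tm v b" "tgt G = tm v b'" "src G1 = tm v1 b" "tgt G1 = tm v1 b'" "src G2 = tm v2 b" "tgt G2 = tm v2 b'"
      using wf by simp_all
    note xi = xi_in[OF ty(1) ok'(1)] xi_in[OF ty(2) ok'(2)] xi_in[OF ty(3) ok'(3)] xi_in[OF ty(4) ok'(4)]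
    note [simp] = ty xi
    have in_a: "F1 = F" "F2 = U" "xi a = tm v a" "xi a' = tm v a'" if "in1 a"
      using that wf xi_in1 by simp_all
    have in_a2: "F2 = F" "F1 = U" "xi a = tm v a" "xi a' = tm v a'" if "in2 a"
      using that wf xi_in2 by simp_all
    have in_b: "G1 = G" "G2 = U" "xi b = tm v b" "xi b' = tm v b'" if "in1 b"
      using that wf xi_in1 by simp_all
    have in_b2: "G2 = G" "G1 = U" "xi b = tm v b" "xi b' = tm v b'" if "in2 b"
      using that wf xi_in2 by simp_all
    consider "p < j" | "j = p" "in1 a" | "j = p" "in2 b" | "j < p" "in1 a" "in1 b"
      | "j < p" "in2 a" "in2 b" | "j < p" "in1 a" "in2 a" | "j < p" "in1 b" "in2 b"
      using ok by auto
    then show ?thesis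
    proof cases
      case 1
      let ?ic = "ic p j (tm v1 a) (tm v1 b) (tm v2 a) (tm v2 b)"
      have jn: "j \<le> n" using j by simp
      \<comment> \<open>The arguments of the interchange are written as targets of the four
        restrictions to match \<open>ic_natural\<close>.\<close>
      have "ten p (ten j F1 G1) (ten j F2 G2) \<bullet> xi (a' \<otimes>\<^bsub>j\<^esub> b') =
         (ten p (ten j F1 G1) (ten j F2 G2) \<bullet> ic p j (tgt F1) (tgt G1) (tgt F2) (tgt G2)) \<bullet> ten j (xi a') (xi b')"
        using 1 j by (simp add: comp_assoc)
      also have "\<dots> = (?ic \<bullet> ten j (ten p F1 F2) (ten p G1 G2)) \<bullet> ten j (xi a') (xi b')"
        using 1 j by (subst ic_natural) simp_all
      also have "\<dots> = ?ic \<bullet> ten j (ten p F1 F2 \<bullet> xi a') (ten p G1 G2 \<bullet> xi b')"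
        using 1 j by (simp add: comp_assoc ten_comp)
      also have "\<dots> = (?ic \<bullet> ten j (xi a) (xi b)) \<bullet> ten j F G"
        unfolding nat using 1 j by (simp add: comp_assoc ten_comp)
      finally show ?thesis
        using 1 by simp
    next
      case 2
      \<comment> \<open>Here \<open>F1 = F\<close>, \<open>F2 = U\<close> and \<open>xi a'\<close>
        is an identity, so after rebracketing both sides are \<open>F\<close> tensored with the
        square for \<open>b\<close>.\<close>
      have "ten p (ten p F G1) (ten p U G2) \<bullet> ten p (tm v a') (xi b') =
          ten p (F \<bullet> tm v a') (ten p G1 G2 \<bullet> xi b')"
        by (simp add: ten_assoc ten_comp)
      also have "\<dots> = ten p (tm v a \<bullet> F) (xi b \<bullet> G)"
        unfolding nat by (simp add: ide_comp comp_ide)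
      also have "\<dots> = ten p (tm v a) (xi b) \<bullet> ten p F G"
        by (simp add: ten_comp)
      finally show ?thesis
        using 2 in_a by simp
    next
      case 3
      have "ten p (ten p F1 U) (ten p F2 G) \<bullet> ten p (xi a') (tm v b') =
          ten p (ten p F1 F2 \<bullet> xi a') (G \<bullet> tm v b')"
        by (simp add: ten_assoc ten_comp)
      also have "\<dots> = ten p (xi a \<bullet> F) (tm v b \<bullet> G)"
        unfolding nat by (simp add: ide_comp comp_ide)
      also have "\<dots> = ten p (xi a) (tm v b) \<bullet> ten p F G"
        by (simp add: ten_comp)
      finally show ?thesis
        using 3 in_b2 by simp
    next
      case 4
      then show ?thesis using j in_a in_b by (simp add: ide_comp comp_ide)
    next
      case 5
      then show ?thesis using j in_a2 in_b2 by (simp add: ide_comp comp_ide)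
    next
      case 6
      \<comment> \<open>A factor without variables satisfies \<open>F1 = F\<close> by
        \<open>in1\<close> and \<open>F1 = U\<close> by \<open>in2\<close>.\<close>
      then have "F = U" "F1 = U" "F2 = U" "xi a = U" "xi a' = U"
        using in_a in_a2 tm_in12 wf by simp_all
      then show ?thesis using 6 j nat by simp
    next
      case 7
      then have "G = U" "G1 = U" "G2 = U" "xi b = U" "xi b' = U"
        using in_b in_b2 tm_in12 wf by simp_all
      then show ?thesis using 7 j nat by simp
    qed
  qed
  have "admissible (a \<otimes>\<^bsub>j\<^esub> b) \<Longrightarrow> admissible (a' \<otimes>\<^bsub>j\<^esub> b')" using wf by auto
  with eq show ?thesis
    using wf j by (simp add: natural_def wf_tensor)
qed

text \<open>The position of \<open>j\<close> relative to \<open>p\<close> decides the law: the giant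
  hexagon for \<open>p < j < k\<close>, internal associativity for \<open>j = p\<close>, and the
  unit laws for \<open>j < p\<close>, where all variables are on one side or two arguments have
  none.\<close>

lemma natural_ic:
  assumes jk: "1 \<le> j" "j < k" "k \<le> n"
    and wf: "a \<in> wf_terms (Mon n)" "b \<in> wf_terms (Mon n)" "c \<in> wf_terms (Mon n)" "d \<in> wf_terms (Mon n)"
  shows "natural ((a \<otimes>\<^bsub>k\<^esub> b) \<otimes>\<^bsub>j\<^esub> (c \<otimes>\<^bsub>k\<^esub> d)) ((a \<otimes>\<^bsub>j\<^esub> c) \<otimes>\<^bsub>k\<^esub> (b \<otimes>\<^bsub>j\<^esub> d))
    (ic j k (tm v1 a) (tm v1 b) (tm v1 c) (tm v1 d)) (ic j k (tm v2 a) (tm v2 b) (tm v2 c) (tm v2 d))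
    (ic j k (tm v a) (tm v b) (tm v c) (tm v d))"
proof -
  let ?a = "tm v a" and ?b = "tm v b" and ?c = "tm v c" and ?d = "tm v d"
    and ?a1 = "tm v1 a" and ?b1 = "tm v1 b" and ?c1 = "tm v1 c" and ?d1 = "tm v1 d"
    and ?a2 = "tm v2 a" and ?b2 = "tm v2 b" and ?c2 = "tm v2 c" and ?d2 = "tm v2 d"
  let ?s = "(a \<otimes>\<^bsub>k\<^esub> b) \<otimes>\<^bsub>j\<^esub> (c \<otimes>\<^bsub>k\<^esub> d)" and ?t = "(a \<otimes>\<^bsub>j\<^esub> c) \<otimes>\<^bsub>k\<^esub> (b \<otimes>\<^bsub>j\<^esub> d)"
  have jk': "Suc 0 \<le> j" "j \<le> n" "Suc 0 \<le> k" "k \<in> {1..n}" using jk by auto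
  have wf': "?s \<in> wf_terms (Mon n)" "?t \<in> wf_terms (Mon n)"
    using wf jk' jk by (auto intro!: wf_tensor)
  \<comment> \<open>The interchange alters only how \<open>a\<close> meets \<open>d\<close> and how
    \<open>b\<close> meets \<open>c\<close>: the index rises from \<open>j\<close> to
    \<open>k\<close>, the order being kept for the first pair and reversed for the second. The
    condition \<ge> \<open>p\<close> or > \<open>p\<close> on the index survives both
    changes.\<close>
  have ok_t: "admissible ?t" if "admissible ?s"
    using that jk by (cases "p < j"; cases "j = p"; cases "p < k"; cases "k = p"; simp) argo+
  have eq: "ten p (ic j k ?a1 ?b1 ?c1 ?d1) (ic j k ?a2 ?b2 ?c2 ?d2) \<bullet> xi ?t = xi ?s \<bullet> ic j k ?a ?b ?c ?d"
    if ok: "admissible ?s"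
  proof -
    have "admissible a" "admissible b" "admissible c" "admissible d" using ok by simp_all
    note xi = xi_in[OF wf(1) this(1)] xi_in[OF wf(2) this(2)] xi_in[OF wf(3) this(3)] xi_in[OF wf(4) this(4)]
    note [simp] = wf xi jk jk'
    consider "p < j" | "j = p" "in1 a" "in1 b" | "j = p" "in2 c" "in2 d"
      | "j < p" "in1 ?s" | "j < p" "in2 ?s"
      | "j < p" "in1 a" "in2 a" "in1 b" "in2 b" | "j < p" "in1 c" "in2 c" "in1 d" "in2 d"
      using ok by auto
    then show ?thesis
    proof cases
      case 1
      let ?P = "ic p j (ten k ?a1 ?b1) (ten k ?c1 ?d1) (ten k ?a2 ?b2) (ten k ?c2 ?d2)"
        and ?Q = "ic p k (ten j ?a1 ?c1) (ten j ?b1 ?d1) (ten j ?a2 ?c2) (ten j ?b2 ?d2)"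
      have pk: "p < k" using less_trans[OF 1 jk(2)] .
      have "ten p (ic j k ?a1 ?b1 ?c1 ?d1) (ic j k ?a2 ?b2 ?c2 ?d2) \<bullet> xi ?t =
          (ten p (ic j k ?a1 ?b1 ?c1 ?d1) (ic j k ?a2 ?b2 ?c2 ?d2) \<bullet> ?Q
            \<bullet> ten k (ic p j ?a1 ?c1 ?a2 ?c2) (ic p j ?b1 ?d1 ?b2 ?d2))
          \<bullet> ten k (ten j (xi a) (xi c)) (ten j (xi b) (xi d))"
        using 1 pk by (simp add: ten_comp comp_assoc)
      \<comment> \<open>The hexagon is applied to the first and second restrictions of
        \<open>a\<close>, \<open>b\<close>, \<open>c\<close>, \<open>d\<close>. The resulting
        objects \<open>ten p ?a1 ?a2\<close> and so on are written as sources of \<open>xi\<close>,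
        the form needed for naturality of \<open>ic j k\<close> two steps later.\<close>
      also have "\<dots> = (?P \<bullet> ten j (ic p k ?a1 ?b1 ?a2 ?b2) (ic p k ?c1 ?d1 ?c2 ?d2)
            \<bullet> ic j k (src (xi a)) (src (xi b)) (src (xi c)) (src (xi d)))
          \<bullet> ten k (ten j (xi a) (xi c)) (ten j (xi b) (xi d))"
        using 1 by (subst ic_hexagon) simp_all
      also have "\<dots> = (?P \<bullet> ten j (ic p k ?a1 ?b1 ?a2 ?b2) (ic p k ?c1 ?d1 ?c2 ?d2))
            \<bullet> (ic j k (src (xi a)) (src (xi b)) (src (xi c)) (src (xi d))
                 \<bullet> ten k (ten j (xi a) (xi c)) (ten j (xi b) (xi d)))"
        using 1 pk by (simp add: comp_assoc)
      also have "\<dots> = (?P \<bullet> ten j (ic p k ?a1 ?b1 ?a2 ?b2) (ic p k ?c1 ?d1 ?c2 ?d2))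
            \<bullet> (ten j (ten k (xi a) (xi b)) (ten k (xi c) (xi d)) \<bullet> ic j k ?a ?b ?c ?d)"
        by (subst ic_natural[symmetric]) simp_all
      also have "\<dots> = xi ?s \<bullet> ic j k ?a ?b ?c ?d"
        using 1 pk by (simp add: ten_comp comp_assoc)
      finally show ?thesis .
    next
      case 2
      have in_ab: "?a1 = ?a" "?b1 = ?b" "?a2 = U" "?b2 = U" "xi a = ?a" "xi b = ?b"
        using 2 tm_in1 xi_in1 by simp_all
      have pk: "p < k" "1 \<le> p" "k \<le> n" using 2 jk by simp_all
      let ?X = "ten k (ten p ?a (xi c)) (ten p ?b (xi d))"
      \<comment> \<open>Since \<open>a\<close> and \<open>b\<close> lie on the first side, the
        second restriction of the interchange is the identity \<open>ten k ?c2 ?d2\<close>. Internal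
        associativity is used for the pairs \<open>(?a, ?b)\<close>, \<open>(?c1, ?d1)\<close>,
        \<open>(?c2, ?d2)\<close>.\<close>
      have "ten p (ic p k ?a ?b ?c1 ?d1) (ten k ?c2 ?d2) \<bullet> ic p k (ten p ?a ?c1) (ten p ?b ?d1) ?c2 ?d2 \<bullet> ?X =
          (ten p (ic p k ?a ?b ?c1 ?d1) (ten k ?c2 ?d2) \<bullet> ic p k (ten p ?a ?c1) (ten p ?b ?d1) ?c2 ?d2) \<bullet> ?X"
        using pk by (simp add: comp_assoc ten_assoc)
      also have "\<dots> = (ten p (ten k ?a ?b) (ic p k ?c1 ?d1 ?c2 ?d2)
            \<bullet> ic p k (src ?a) (src ?b) (src (xi c)) (src (xi d))) \<bullet> ?X"
        using pk by (subst ic_internal) simp_all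
      also have "\<dots> = ten p (ten k ?a ?b) (ic p k ?c1 ?d1 ?c2 ?d2)
            \<bullet> (ic p k (src ?a) (src ?b) (src (xi c)) (src (xi d)) \<bullet> ?X)"
        using pk by (simp add: comp_assoc)
      also have "\<dots> = ten p (ten k ?a ?b) (ic p k ?c1 ?d1 ?c2 ?d2)
            \<bullet> (ten p (ten k ?a ?b) (ten k (xi c) (xi d)) \<bullet> ic p k ?a ?b ?c ?d)"
        using pk by (subst ic_natural[symmetric]) simp_all
      also have "\<dots> = ten p (ten k ?a ?b \<bullet> ten k ?a ?b) (ic p k ?c1 ?d1 ?c2 ?d2 \<bullet> ten k (xi c) (xi d))
            \<bullet> ic p k ?a ?b ?c ?d"
        using pk by (simp add: comp_assoc ten_comp)
      finally show ?thesis
        using 2 pk by (simp add: in_ab ic_unit ide_comp)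
    next
      case 3
      have in_cd: "?c1 = U" "?d1 = U" "?c2 = ?c" "?d2 = ?d" "xi c = ?c" "xi d = ?d"
        using 3 tm_in2 xi_in2 by simp_all
      have pk: "p < k" "1 \<le> p" "k \<le> n" using 3 jk by simp_all
      let ?X = "ten k (ten p (xi a) ?c) (ten p (xi b) ?d)"
      \<comment> \<open>Mirror image: the first restriction is the identity
        \<open>ten k ?a1 ?b1\<close>, and internal associativity is used for
        \<open>(?a1, ?b1)\<close>, \<open>(?a2, ?b2)\<close>, \<open>(?c, ?d)\<close>.\<close>
      have "ten p (ten k ?a1 ?b1) (ic p k ?a2 ?b2 ?c ?d) \<bullet> ic p k ?a1 ?b1 (ten p ?a2 ?c) (ten p ?b2 ?d) \<bullet> ?X =
          (ten p (ten k ?a1 ?b1) (ic p k ?a2 ?b2 ?c ?d) \<bullet> ic p k ?a1 ?b1 (ten p ?a2 ?c) (ten p ?b2 ?d)) \<bullet> ?X"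
        using pk by (simp add: comp_assoc ten_assoc)
      also have "\<dots> = (ten p (ic p k ?a1 ?b1 ?a2 ?b2) (ten k ?c ?d)
            \<bullet> ic p k (src (xi a)) (src (xi b)) (src ?c) (src ?d)) \<bullet> ?X"
        using pk by (subst ic_internal[symmetric]) simp_all
      also have "\<dots> = ten p (ic p k ?a1 ?b1 ?a2 ?b2) (ten k ?c ?d)
            \<bullet> (ic p k (src (xi a)) (src (xi b)) (src ?c) (src ?d) \<bullet> ?X)"
        using pk by (simp add: comp_assoc)
      also have "\<dots> = ten p (ic p k ?a1 ?b1 ?a2 ?b2) (ten k ?c ?d)
            \<bullet> (ten p (ten k (xi a) (xi b)) (ten k ?c ?d) \<bullet> ic p k ?a ?b ?c ?d)"
        using pk by (subst ic_natural[symmetric]) simp_all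
      also have "\<dots> = ten p (ic p k ?a1 ?b1 ?a2 ?b2 \<bullet> ten k (xi a) (xi b)) (ten k ?c ?d \<bullet> ten k ?c ?d)
            \<bullet> ic p k ?a ?b ?c ?d"
        using pk by (simp add: comp_assoc ten_comp)
      finally show ?thesis
        using 3 pk by (simp add: in_cd ic_unit ide_comp)
    next
      case 4
      have "in1 ?t" using 4 by simp
      then have "xi ?t = tm v ?t" "xi ?s = tm v ?s"
        using 4 wf' by (simp_all only: xi_in1)
      moreover have "?a1 = ?a" "?b1 = ?b" "?c1 = ?c" "?d1 = ?d" "?a2 = U" "?b2 = U" "?c2 = U" "?d2 = U"
        using 4 tm_in1 by simp_all
      ultimately show ?thesis
        by (simp add: ic_unit ide_comp comp_ide del: xi_simps)
    next
      case 5
      have "in2 ?t" using 5 by simp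
      then have "xi ?t = tm v ?t" "xi ?s = tm v ?s"
        using 5 wf' by (simp_all only: xi_in2)
      moreover have "?a2 = ?a" "?b2 = ?b" "?c2 = ?c" "?d2 = ?d" "?a1 = U" "?b1 = U" "?c1 = U" "?d1 = U"
        using 5 tm_in2 by simp_all
      ultimately show ?thesis
        by (simp add: ic_unit ide_comp comp_ide del: xi_simps)
    next
      case 6
      then have "?a = U" "?b = U" "?a1 = U" "?b1 = U" "?a2 = U" "?b2 = U" "xi a = U" "xi b = U"
        using tm_in12 tm_in1 tm_in2 xi_in1 by simp_all
      \<comment> \<open>When \<open>k\<close> is at most \<open>p\<close>, what precedes
        \<open>xi\<close> of the product of \<open>c\<close> and \<open>d\<close> is its own
        source.\<close>
      moreover have "ten p (ten k ?c1 ?d1) (ten k ?c2 ?d2) \<bullet> ten k (xi c) (xi d) = ten k (xi c) (xi d)" if "\<not> p < k"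
        using xi_in[of "c \<otimes>\<^bsub>k\<^esub> d"] ok that wf_tensor[OF wf(3,4) jk'(4)] by (simp add: ide_comp)
      ultimately show ?thesis
        using 6 by (simp add: ic_unit ide_comp comp_ide)
    next
      case 7
      then have "?c = U" "?d = U" "?c1 = U" "?d1 = U" "?c2 = U" "?d2 = U" "xi c = U" "xi d = U"
        using tm_in12 tm_in1 tm_in2 xi_in1 by simp_all
      moreover have "ten p (ten k ?a1 ?b1) (ten k ?a2 ?b2) \<bullet> ten k (xi a) (xi b) = ten k (xi a) (xi b)" if "\<not> p < k"
        using xi_in[of "a \<otimes>\<^bsub>k\<^esub> b"] ok that wf_tensor[OF wf(1,2) jk'(4)] by (simp add: ide_comp)
      ultimately show ?thesis
        using 7 by (simp add: ic_unit ide_comp comp_ide)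
    qed
  qed
  have "in1 ?s \<longrightarrow> ic j k ?a1 ?b1 ?c1 ?d1 = ic j k ?a ?b ?c ?d \<and> ic j k ?a2 ?b2 ?c2 ?d2 = U"
    "in2 ?s \<longrightarrow> ic j k ?a1 ?b1 ?c1 ?d1 = U \<and> ic j k ?a2 ?b2 ?c2 ?d2 = ic j k ?a ?b ?c ?d"
    using wf jk jk' by (simp_all add: tm_in1 tm_in2 ic_unit)
  moreover have "in1 ?s \<longleftrightarrow> in1 ?t" "in2 ?s \<longleftrightarrow> in2 ?t" by auto
  ultimately show ?thesis
    using eq ok_t wf jk jk' by (simp add: natural_def wf_tensor del: xi_simps admissible_simps in_simps)
qed

text \<open>A rule evaluates to a tensor product of arrows followed by an interchange at objects, so
  \<open>natural_tensor\<close> and \<open>natural_ic\<close> together cover it; term conversions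
  are absorbed by the invariance of \<open>xi\<close>.\<close>

lemma natural_redn: "is_redn (Mon n) f s t \<Longrightarrow> natural s t (ev v1 f) (ev v2 f) (ev v f)"
proof (induction rule: is_redn_Mon_induct)
  case (ident s)
  then show ?case by (simp add: natural_ident)
next
  case unit
  show ?case using natural_ident[OF wf_unit] by simp
next
  case (tensor i f g s s' t t')
  then show ?case by (simp add: natural_tensor)
next
  case (rule i j f g h k a b c d a' b' c' d')
  have ij: "i \<in> {1..n}" "j \<in> {1..n}" using rule.hyps by auto
  have wf: "a' \<in> wf_terms (Mon n)" "b' \<in> wf_terms (Mon n)" "c' \<in> wf_terms (Mon n)" "d' \<in> wf_terms (Mon n)"
    using rule.IH by (simp_all add: natural_def)
  have tgt: "tgt (ev w f) = tm w a'" "tgt (ev w g) = tm w b'" "tgt (ev w h) = tm w c'" "tgt (ev w k) = tm w d'"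
    if "\<And>x. ide (w x)" for w
    using rule.hyps ev_in[of w, OF that] by simp_all
  have "natural ((a \<otimes>\<^bsub>j\<^esub> b) \<otimes>\<^bsub>i\<^esub> (c \<otimes>\<^bsub>j\<^esub> d)) ((a' \<otimes>\<^bsub>j\<^esub> b') \<otimes>\<^bsub>i\<^esub> (c' \<otimes>\<^bsub>j\<^esub> d'))
    (ten i (ten j (ev v1 f) (ev v1 g)) (ten j (ev v1 h) (ev v1 k)))
    (ten i (ten j (ev v2 f) (ev v2 g)) (ten j (ev v2 h) (ev v2 k)))
    (ten i (ten j (ev v f) (ev v g)) (ten j (ev v h) (ev v k)))"
    by (intro natural_tensor ij rule.IH)
  from natural_comp[OF this natural_ic[OF rule.hyps(1-3) wf]] show ?case
    by (simp add: rule_op_def numeral_eq_Suc tgt)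
next
  case (comp f g s t u)
  then show ?case by (simp add: natural_comp)
next
  case (conv f s t s' t')
  then show ?case by (blast intro: natural_conv)
qed

end

section \<open>Restriction by substituting units, and uniqueness of evaluation\<close>

lemma tsubst_ident: "\<forall>x\<in>set (vars t). \<sigma> x = Var x \<Longrightarrow> tsubst \<sigma> t = t"
  by (induction t) (auto intro: map_idI)

lemma term_eq_tsubst_unit:
  "t \<in> wf_terms (Mon n) \<Longrightarrow> \<forall>x\<in>set (vars t). \<sigma> x = \<I> \<Longrightarrow> term_eq (Mon n) (tsubst \<sigma> t) \<I>"
proof (induction rule: wf_Mon_induct)
  case (tensor i a b)
  then show ?case
    by (auto intro!: te_tensor_unit(1) wf_unit)
qed (auto intro: te_refl wf_unit)

lemma inst_redn_is:
  assumes "is_redn (Mon n) f s t" "\<And>x. \<sigma> x \<in> wf_terms (Mon n)"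
  shows "is_redn (Mon n) (inst_redn \<sigma> f) (tsubst \<sigma> s) (tsubst \<sigma> t)"
  using assms(2) by (intro subst_redn_is[OF is_two_theory_Mon assms(1)]) (auto intro: red_id)

text \<open>Induction on the source, with the target arbitrary because restriction replaces
  \<open>b\<close> by a substitution instance of it.\<close>

theorem (in strict_nfold_monoidal) ev_unique:
  assumes v: "\<And>x. ide (v x)"
  shows "a \<in> wf_terms (Mon n) \<Longrightarrow> distinct (vars a) \<Longrightarrow> is_redn (Mon n) f a b \<Longrightarrow> is_redn (Mon n) g a b \<Longrightarrow>
    ev v f = ev v g"
proof (induction arbitrary: f g b rule: wf_Mon_induct)
  case (Var x)
  \<comment> \<open>A single variable is within the bound of \<open>ev_small\<close>, so both
    reductions evaluate to \<open>tm v\<close> of the source.\<close>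
  have "length (filter (\<lambda>y. v y \<noteq> U) (vars (Var x))) \<le> 1" by simp
  then show ?case
    using ev_small[OF v Var.prems(2)] ev_small[OF v Var.prems(3)] by simp
next
  case unit
  have "length (filter (\<lambda>y. v y \<noteq> U) (vars \<I>)) \<le> 1" by simp
  then show ?case
    using ev_small[OF v unit.prems(2)] ev_small[OF v unit.prems(3)] by simp
next
  case (tensor i a1 a2)
  \<comment> \<open>Absence of repeated variables makes the variables of \<open>a1\<close> and
    \<open>a2\<close> disjoint, which is what a separating \<open>S\<close> requires.\<close>
  obtain S where S: "set (vars a1) \<subseteq> S" "\<forall>x\<in>set (vars a2). x \<notin> S"
    using tensor.prems(1) that[of "set (vars a1)"] by auto
  interpret splitting n arr src tgt comp ten U ic ide i S v
    using tensor.hyps(1) v by unfold_locales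
  have in12: "in1 a1" "in2 a2"
    using S by (simp_all add: in1_def in2_def)
  have ok_sub: "admissible t" if "t \<in> wf_terms (Mon n)" "in1 t \<or> in2 t" for t
    using that by (induction rule: wf_Mon_induct) auto
  have ok: "admissible (a1 \<otimes>\<^bsub>i\<^esub> a2)"
    using in12 ok_sub tensor.hyps by auto
  have xi: "xi (a1 \<otimes>\<^bsub>i\<^esub> a2) = tm v (a1 \<otimes>\<^bsub>i\<^esub> a2)"
    using in12 tensor.hyps by (simp add: xi_in1 xi_in2)
  define \<sigma>1 where "\<sigma>1 x = (if x \<in> S then Var x else \<I>)" for x
  define \<sigma>2 where "\<sigma>2 x = (if x \<in> S then \<I> else Var x)" for x
  have \<sigma>: "\<sigma>1 x \<in> wf_terms (Mon n)" "\<sigma>2 x \<in> wf_terms (Mon n)" for x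
    by (auto simp: \<sigma>1_def \<sigma>2_def intro: wf_mon)
  have "tsubst \<sigma>1 a1 = a1" "tsubst \<sigma>2 a2 = a2"
    using S by (auto simp: \<sigma>1_def \<sigma>2_def intro!: tsubst_ident)
  moreover have "term_eq (Mon n) (tsubst \<sigma>1 a2) \<I>" "term_eq (Mon n) (tsubst \<sigma>2 a1) \<I>"
    using S tensor.hyps by (auto intro!: term_eq_tsubst_unit simp: \<sigma>1_def \<sigma>2_def)
  ultimately have \<sigma>a: "term_eq (Mon n) (tsubst \<sigma>1 (a1 \<otimes>\<^bsub>i\<^esub> a2)) a1" "term_eq (Mon n) (tsubst \<sigma>2 (a1 \<otimes>\<^bsub>i\<^esub> a2)) a2"
    using tensor.hyps by (simp_all add: te_tensor_unit te_refl)
  \<comment> \<open>Evaluation at \<open>v1\<close> or \<open>v2\<close> becomes evaluation of a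
    substituted reduction at \<open>v\<close>, so the valuation can stay fixed throughout the
    induction.\<close>
  have v12: "v1 = (\<lambda>x. tm v (\<sigma>1 x))" "v2 = (\<lambda>x. tm v (\<sigma>2 x))"
    by (auto simp: v1_def v2_def \<sigma>1_def \<sigma>2_def)
  have b: "b \<in> wf_terms (Mon n)"
    using is_redn_wf[OF is_two_theory_Mon] tensor.prems(2) by blast
  have refl: "term_eq (Mon n) (tsubst \<tau> b) (tsubst \<tau> b)" if "\<And>x. \<tau> x \<in> wf_terms (Mon n)" for \<tau>
    using b that by (auto intro!: te_refl wf_tsubst)
  \<comment> \<open>The substituted units cancel in the source. The target depends only on
    \<open>b\<close>, so the restrictions of \<open>f\<close> and \<open>g\<close> stay
    parallel.\<close>
  have restr: "is_redn (Mon n) (inst_redn \<sigma>1 h) a1 (tsubst \<sigma>1 b)" "is_redn (Mon n) (inst_redn \<sigma>2 h) a2 (tsubst \<sigma>2 b)"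
    if "is_redn (Mon n) h (a1 \<otimes>\<^bsub>i\<^esub> a2) b" for h
    using red_conv[OF inst_redn_is[OF that] \<sigma>a(1) refl] red_conv[OF inst_redn_is[OF that] \<sigma>a(2) refl] \<sigma> by auto
  have split: "ev v h = ten i (ev v1 h) (ev v2 h) \<bullet> xi b" if "is_redn (Mon n) h (a1 \<otimes>\<^bsub>i\<^esub> a2) b" for h
  proof -
    have "ten i (ev v1 h) (ev v2 h) \<bullet> xi b = tm v (a1 \<otimes>\<^bsub>i\<^esub> a2) \<bullet> ev v h"
      using natural_redn[OF that] ok unfolding natural_def xi by blast
    also have "\<dots> = ev v h"
      using ev_in[of v, OF v that] by (metis src_comp)
    finally show ?thesis by simp
  qed
  have d: "distinct (vars a1)" "distinct (vars a2)"
    using tensor.prems(1) by simp_all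
  have "ev v1 f = ev v1 g"
    unfolding v12 ev_inst_redn[symmetric]
    by (rule tensor.IH(1)[OF d(1) restr(1)[OF tensor.prems(2)] restr(1)[OF tensor.prems(3)]])
  moreover have "ev v2 f = ev v2 g"
    unfolding v12 ev_inst_redn[symmetric]
    by (rule tensor.IH(2)[OF d(2) restr(2)[OF tensor.prems(2)] restr(2)[OF tensor.prems(3)]])
  ultimately show ?case
    using split[OF tensor.prems(2)] split[OF tensor.prems(3)] by simp
qed

section \<open>Reductions modulo congruence\<close>

text \<open>Endpoints read off the syntax. By \<open>is_redn_src_tgt\<close> they agree modulo
  \<open>term_eq\<close> with any endpoints a reduction can be given, so they serve as canonical
  representatives.\<close>

primrec redn_src :: "mon_redn \<Rightarrow> mon_trm" where
  "redn_src (Ident s) = s"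
| "redn_src (FunR f \<phi>s) = App f (map redn_src \<phi>s)"
| "redn_src (RuleR r \<phi>s) = (map redn_src \<phi>s ! 0 \<otimes>\<^bsub>snd r\<^esub> map redn_src \<phi>s ! 1)
    \<otimes>\<^bsub>fst r\<^esub> (map redn_src \<phi>s ! 2 \<otimes>\<^bsub>snd r\<^esub> map redn_src \<phi>s ! 3)"
| "redn_src (\<phi> \<cdot> \<psi>) = redn_src \<phi>"

primrec redn_tgt :: "mon_redn \<Rightarrow> mon_trm" where
  "redn_tgt (Ident s) = s"
| "redn_tgt (FunR f \<phi>s) = App f (map redn_tgt \<phi>s)"
| "redn_tgt (RuleR r \<phi>s) = (map redn_tgt \<phi>s ! 0 \<otimes>\<^bsub>fst r\<^esub> map redn_tgt \<phi>s ! 2)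
    \<otimes>\<^bsub>snd r\<^esub> (map redn_tgt \<phi>s ! 1 \<otimes>\<^bsub>fst r\<^esub> map redn_tgt \<phi>s ! 3)"
| "redn_tgt (\<phi> \<cdot> \<psi>) = redn_tgt \<psi>"

text \<open>Substitutions must be defined, and well typed, at every variable, whereas each axiom
  involves finitely many; the default \<open>d\<close> fills the rest, where \<open>xs ! k\<close>
  would be unspecified.\<close>

primrec pad :: "'a \<Rightarrow> 'a list \<Rightarrow> nat \<Rightarrow> 'a" where
  "pad d [] k = d"
| "pad d (x # xs) k = (case k of 0 \<Rightarrow> x | Suc m \<Rightarrow> pad d xs m)"

lemma pad_all: "P d \<Longrightarrow> \<forall>x\<in>set xs. P x \<Longrightarrow> P (pad d xs k)"
  by (induction xs arbitrary: k) (auto split: nat.split)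

lemma red_rule4:
  assumes "1 \<le> i" "i < j" "j \<le> n" "is_redn (Mon n) f a a'" "is_redn (Mon n) g b b'"
    "is_redn (Mon n) h c c'" "is_redn (Mon n) k d d'"
  shows "is_redn (Mon n) (RuleR (i, j) [f, g, h, k])
    ((a \<otimes>\<^bsub>j\<^esub> b) \<otimes>\<^bsub>i\<^esub> (c \<otimes>\<^bsub>j\<^esub> d)) ((a' \<otimes>\<^bsub>i\<^esub> c') \<otimes>\<^bsub>j\<^esub> (b' \<otimes>\<^bsub>i\<^esub> d'))"
proof -
  have "is_redn (Mon n) (RuleR (i, j) [f, g, h, k])
     (plug (rule_src (Mon n) (i, j)) [a, b, c, d]) (plug (rule_tgt (Mon n) (i, j)) [a', b', c', d'])"
    using assms by (intro red_rule) (auto simp: less_Suc_eq numeral_eq_Suc)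
  then show ?thesis by (simp add: numeral_eq_Suc)
qed

lemma re_rule4:
  assumes "1 \<le> i" "i < j" "j \<le> n" "redn_eq (Mon n) f f' a a'" "redn_eq (Mon n) g g' b b'"
    "redn_eq (Mon n) h h' c c'" "redn_eq (Mon n) k k' d d'"
  shows "redn_eq (Mon n) (RuleR (i, j) [f, g, h, k]) (RuleR (i, j) [f', g', h', k'])
    ((a \<otimes>\<^bsub>j\<^esub> b) \<otimes>\<^bsub>i\<^esub> (c \<otimes>\<^bsub>j\<^esub> d)) ((a' \<otimes>\<^bsub>i\<^esub> c') \<otimes>\<^bsub>j\<^esub> (b' \<otimes>\<^bsub>i\<^esub> d'))"
proof -
  have "redn_eq (Mon n) (RuleR (i, j) [f, g, h, k]) (RuleR (i, j) [f', g', h', k'])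
     (plug (rule_src (Mon n) (i, j)) [a, b, c, d]) (plug (rule_tgt (Mon n) (i, j)) [a', b', c', d'])"
    using assms by (intro re_rule) (auto simp: less_Suc_eq numeral_eq_Suc)
  then show ?thesis by (simp add: numeral_eq_Suc)
qed

lemma re_tensor:
  assumes "i \<in> {1..n}" "redn_eq (Mon n) f f' a a'" "redn_eq (Mon n) g g' b b'"
  shows "redn_eq (Mon n) (f \<^bold>\<otimes>\<^bsub>i\<^esub> g) (f' \<^bold>\<otimes>\<^bsub>i\<^esub> g') (a \<otimes>\<^bsub>i\<^esub> b) (a' \<otimes>\<^bsub>i\<^esub> b')"
  using assms by (intro re_fun) (auto simp: all_less_2)

context
  fixes n :: nat
begin

section \<open>Well-typed reductions and their congruence classes\<close>

definition wt :: "mon_redn \<Rightarrow> bool" where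
  "wt f \<longleftrightarrow> is_redn (Mon n) f (redn_src f) (redn_tgt f)"

text \<open>The endpoints can be quantified away since, by \<open>redn_eq_typed\<close>, congruent
  reductions have the same ones modulo \<open>term_eq\<close>. This yields the single-sorted arrows
  that the locale expects.\<close>

definition cls :: "mon_redn \<Rightarrow> mon_redn set" where
  "cls f = {g. \<exists>s t. redn_eq (Mon n) f g s t}"

lemma is_redn_src_tgt:
  "is_redn (Mon n) f s t \<Longrightarrow> term_eq (Mon n) s (redn_src f) \<and> term_eq (Mon n) t (redn_tgt f)"
proof (induction rule: is_redn_Mon_induct)
  case (rule i j f g h k a b c d a' b' c' d')
  then have "i \<in> {1..n}" "j \<in> {1..n}" by auto
  then show ?case using rule.IH by (simp add: numeral_eq_Suc te_tensor)
next
  case (conv f s t s' t')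
  then show ?case by (blast intro: te_trans te_sym)
qed (auto intro: te_refl te_tensor wf_unit)

lemma wtI: "is_redn (Mon n) f s t \<Longrightarrow> wt f"
  unfolding wt_def using is_redn_src_tgt red_conv by blast

lemma wt_wf: "wt f \<Longrightarrow> redn_src f \<in> wf_terms (Mon n) \<and> redn_tgt f \<in> wf_terms (Mon n)"
  unfolding wt_def using is_redn_wf[OF is_two_theory_Mon] by blast

lemma wt_Ident: "s \<in> wf_terms (Mon n) \<Longrightarrow> wt (Ident s)"
  by (auto intro: wtI red_id)

lemma wt_unit: "wt (FunR Unit [])"
  by (rule wtI[of _ \<I> \<I>], rule red_fun) auto

lemma wt_tensor: "i \<in> {1..n} \<Longrightarrow> wt f \<Longrightarrow> wt g \<Longrightarrow> wt (f \<^bold>\<otimes>\<^bsub>i\<^esub> g)"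
  unfolding wt_def by (simp add: red_tensor)

lemma wt_rule: "\<lbrakk>1 \<le> i; i < j; j \<le> n; wt f; wt g; wt h; wt k\<rbrakk> \<Longrightarrow> wt (RuleR (i, j) [f, g, h, k])"
  unfolding wt_def by (simp add: red_rule4 numeral_eq_Suc)

lemma comp_typed: "wt f \<Longrightarrow> wt g \<Longrightarrow> term_eq (Mon n) (redn_tgt f) (redn_src g) \<Longrightarrow>
   is_redn (Mon n) g (redn_tgt f) (redn_tgt g)"
  unfolding wt_def using is_redn_wf[OF is_two_theory_Mon] by (blast intro: red_conv te_sym te_refl)

lemma wt_comp: "wt f \<Longrightarrow> wt g \<Longrightarrow> term_eq (Mon n) (redn_tgt f) (redn_src g) \<Longrightarrow> wt (f \<cdot> g)"
  using comp_typed[of f g] unfolding wt_def by (simp add: red_comp)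

lemma redn_eq_typed:
  assumes "redn_eq (Mon n) f g s t"
  shows "wt f" "wt g" "redn_eq (Mon n) f g (redn_src f) (redn_tgt f)"
    "term_eq (Mon n) (redn_src f) (redn_src g)" "term_eq (Mon n) (redn_tgt f) (redn_tgt g)"
proof -
  have fg: "is_redn (Mon n) f s t" "is_redn (Mon n) g s t"
    using redn_eq_is_redn[OF is_two_theory_Mon assms] by auto
  show "wt f" "wt g" using fg wtI by auto
  show "redn_eq (Mon n) f g (redn_src f) (redn_tgt f)"
    using assms is_redn_src_tgt[OF fg(1)] by (blast intro: re_conv)
  show "term_eq (Mon n) (redn_src f) (redn_src g)" "term_eq (Mon n) (redn_tgt f) (redn_tgt g)"
    using is_redn_src_tgt[OF fg(1)] is_redn_src_tgt[OF fg(2)] by (blast intro: te_trans te_sym)+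
qed

lemma cls_eqI:
  assumes "redn_eq (Mon n) f g s t"
  shows "cls f = cls g"
proof -
  have sub: "cls g \<subseteq> cls f" if fg: "redn_eq (Mon n) f g s t" for f g s t
  proof
    fix h assume "h \<in> cls g"
    then obtain s' t' where "redn_eq (Mon n) g h s' t'" by (auto simp: cls_def)
    note gh = redn_eq_typed(3)[OF this] and fg' = redn_eq_typed(3-5)[OF fg]
    have "redn_eq (Mon n) g h (redn_src f) (redn_tgt f)"
      by (rule re_conv[OF gh te_sym te_sym]) (rule fg')+
    with fg' show "h \<in> cls f" by (auto simp: cls_def intro: re_trans)
  qed
  from sub[OF assms] sub[OF re_sym[OF assms]] show ?thesis by blast
qed

lemma cls_eqD: "wt g \<Longrightarrow> cls f = cls g \<Longrightarrow> redn_eq (Mon n) f g (redn_src f) (redn_tgt f)"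
proof -
  assume "wt g" "cls f = cls g"
  then have "g \<in> cls f" by (auto simp: wt_def cls_def intro: re_refl)
  then show ?thesis using redn_eq_typed(3) by (auto simp: cls_def)
qed

lemma cls_Ident_eq_iff:
  assumes "s \<in> wf_terms (Mon n)" "t \<in> wf_terms (Mon n)"
  shows "cls (Ident s) = cls (Ident t) \<longleftrightarrow> term_eq (Mon n) s t"
proof
  assume "cls (Ident s) = cls (Ident t)"
  from redn_eq_typed(4)[OF cls_eqD[OF wt_Ident[OF assms(2)] this]] show "term_eq (Mon n) s t" by simp
qed (rule cls_eqI[OF re_ident])

text \<open>The operations on classes act on chosen representatives; \<open>msrc_cls\<close>,
  \<open>mtgt_cls\<close>, \<open>mcomp_cls\<close>, \<open>mten_cls\<close> and
  \<open>mic_cls\<close> establish independence of the choice.\<close>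

definition rep :: "mon_redn set \<Rightarrow> mon_redn" where
  "rep M = (SOME f. f \<in> M)"

lemma rep: "wt f \<Longrightarrow> redn_eq (Mon n) f (rep (cls f)) (redn_src f) (redn_tgt f)"
proof -
  assume "wt f"
  then have "f \<in> cls f" by (auto simp: wt_def cls_def intro: re_refl)
  then have "rep (cls f) \<in> cls f" unfolding rep_def by (rule someI)
  then show ?thesis using redn_eq_typed(3) by (auto simp: cls_def)
qed

section \<open>The operations on classes\<close>

definition marr :: "mon_redn set \<Rightarrow> bool" where "marr M \<longleftrightarrow> (\<exists>f. wt f \<and> M = cls f)"
definition msrc :: "mon_redn set \<Rightarrow> mon_redn set" where "msrc M = cls (Ident (redn_src (rep M)))"
definition mtgt :: "mon_redn set \<Rightarrow> mon_redn set" where "mtgt M = cls (Ident (redn_tgt (rep M)))"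
definition mcomp :: "mon_redn set \<Rightarrow> mon_redn set \<Rightarrow> mon_redn set" where
  "mcomp M N = cls (rep M \<cdot> rep N)"
definition mten :: "nat \<Rightarrow> mon_redn set \<Rightarrow> mon_redn set \<Rightarrow> mon_redn set" where
  "mten i M N = cls (rep M \<^bold>\<otimes>\<^bsub>i\<^esub> rep N)"
definition mU :: "mon_redn set" where "mU = cls (Ident \<I>)"
text \<open>On arrows that are not objects this is the diagonal of the naturality square, since a
  rule may take arbitrary reductions as arguments.\<close>

definition mic :: "nat \<Rightarrow> nat \<Rightarrow> mon_redn set \<Rightarrow> mon_redn set \<Rightarrow> mon_redn set \<Rightarrow> mon_redn set \<Rightarrow> mon_redn set" where
  "mic i j A B C D = cls (RuleR (i, j) [rep A, rep B, rep C, rep D])"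
definition mide :: "mon_redn set \<Rightarrow> bool" where "mide M \<longleftrightarrow> marr M \<and> msrc M = M"

lemma
  assumes "wt f"
  shows msrc_cls: "msrc (cls f) = cls (Ident (redn_src f))"
    and mtgt_cls: "mtgt (cls f) = cls (Ident (redn_tgt f))"
  unfolding msrc_def mtgt_def
  by (rule cls_eqI[OF re_ident[OF te_sym]], rule redn_eq_typed[OF rep[OF assms]])+

lemma mcomp_cls:
  assumes "wt f" "wt g" "term_eq (Mon n) (redn_tgt f) (redn_src g)"
  shows "mcomp (cls f) (cls g) = cls (f \<cdot> g)"
proof -
  have "redn_eq (Mon n) g (rep (cls g)) (redn_tgt f) (redn_tgt g)"
    using wt_wf[OF assms(2)] by (intro re_conv[OF rep[OF assms(2)] te_sym[OF assms(3)]] te_refl) simp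
  then show ?thesis
    unfolding mcomp_def using cls_eqI[OF re_comp[OF rep[OF assms(1)]]] by simp
qed

lemma mten_cls: "\<lbrakk>i \<in> {1..n}; wt f; wt g\<rbrakk> \<Longrightarrow> mten i (cls f) (cls g) = cls (f \<^bold>\<otimes>\<^bsub>i\<^esub> g)"
  unfolding mten_def by (rule cls_eqI[OF re_tensor[OF _ re_sym re_sym]]) (assumption | erule rep)+

lemma mic_cls: "\<lbrakk>1 \<le> i; i < j; j \<le> n; wt f; wt g; wt h; wt k\<rbrakk> \<Longrightarrow>
    mic i j (cls f) (cls g) (cls h) (cls k) = cls (RuleR (i, j) [f, g, h, k])"
  unfolding mic_def by (rule cls_eqI[OF re_rule4[OF _ _ _ re_sym re_sym re_sym re_sym]]) (assumption | erule rep)+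

lemma mten_Ident:
  assumes "i \<in> {1..n}" "a \<in> wf_terms (Mon n)" "b \<in> wf_terms (Mon n)"
  shows "mten i (cls (Ident a)) (cls (Ident b)) = cls (Ident (a \<otimes>\<^bsub>i\<^esub> b))"
proof -
  have "redn_eq (Mon n) (FunR (Tensor i) (map Ident [a, b])) (Ident (a \<otimes>\<^bsub>i\<^esub> b)) (a \<otimes>\<^bsub>i\<^esub> b) (a \<otimes>\<^bsub>i\<^esub> b)"
    using assms by (intro re_fun_id) auto
  from cls_eqI[OF this] show ?thesis
    using assms by (simp add: mten_cls wt_Ident)
qed

lemma mU_cls: "mU = cls (FunR Unit [])"
proof -
  have "redn_eq (Mon n) (FunR Unit (map Ident [])) (Ident \<I>) \<I> \<I>"
    by (rule re_fun_id) auto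
  from cls_eqI[OF this] show ?thesis by (simp add: mU_def)
qed

lemma marrE:
  assumes "marr M" obtains f where "wt f" "M = cls f"
  using assms by (auto simp: marr_def)

text \<open>Objects are represented by terms, so the laws of the interchange can be checked at
  identity reductions.\<close>

lemma mideE:
  assumes "mide M" obtains s where "s \<in> wf_terms (Mon n)" "M = cls (Ident s)"
proof -
  obtain f where f: "wt f" "M = cls f" using assms by (auto simp: mide_def marr_def)
  with assms have "M = cls (Ident (redn_src f))" by (simp add: mide_def msrc_cls)
  with wt_wf[OF f(1)] that show ?thesis by blast
qed

text \<open>The equations are stated for variables; \<open>re_subst\<close> with identity reductions
  produces their instances at the terms \<open>ss\<close>.\<close>

lemma cls_inst_axiom:
  assumes "(\<phi>, \<psi>) \<in> redn_eqs (Mon n)" "\<forall>s\<in>set ss. s \<in> wf_terms (Mon n)"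
  shows "cls (inst_redn (pad \<I> ss) \<phi>) = cls (inst_redn (pad \<I> ss) \<psi>)"
proof -
  have wf: "pad \<I> ss x \<in> wf_terms (Mon n)" for x
    using assms(2) by (auto intro!: pad_all wf_unit)
  obtain s t where "is_redn (Mon n) \<phi> s t" "is_redn (Mon n) \<psi> s t"
    using is_two_theory_Mon[of n] assms(1) unfolding is_two_theory_def by blast
  then have "redn_eq (Mon n) \<phi> \<psi> s t" by (rule re_ax[OF assms(1)])
  then have "redn_eq (Mon n) (inst_redn (pad \<I> ss) \<phi>) (inst_redn (pad \<I> ss) \<psi>)
      (tsubst (pad \<I> ss) s) (tsubst (pad \<I> ss) t)"
    by (rule re_subst) (intro allI re_refl red_id wf)+
  then show ?thesis by (rule cls_eqI)
qed

lemma wt_pad: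
  assumes "\<forall>f\<in>set fs. wt f"
  shows "is_redn (Mon n) (pad (FunR Unit []) fs x) (redn_src (pad (FunR Unit []) fs x)) (redn_tgt (pad (FunR Unit []) fs x))"
    "redn_src (pad (FunR Unit []) fs x) \<in> wf_terms (Mon n)" "redn_tgt (pad (FunR Unit []) fs x) \<in> wf_terms (Mon n)"
proof -
  have "wt (pad (FunR Unit []) fs x)"
    using wt_unit assms by (rule pad_all)
  then show "is_redn (Mon n) (pad (FunR Unit []) fs x) (redn_src (pad (FunR Unit []) fs x)) (redn_tgt (pad (FunR Unit []) fs x))"
    "redn_src (pad (FunR Unit []) fs x) \<in> wf_terms (Mon n)" "redn_tgt (pad (FunR Unit []) fs x) \<in> wf_terms (Mon n)"
    using wt_wf unfolding wt_def by blast+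
qed

text \<open>Term equations hold for arrows too: \<open>re_ident\<close> equates the identities of
  \<open>s\<close> and \<open>t\<close>, and substituting reductions for the variables turns these
  identities into \<open>s\<close> and \<open>t\<close> applied to arrows. Associativity and unit
  laws of the products follow.\<close>

lemma cls_term_axiom:
  assumes "term_eq (Mon n) s t" "\<forall>f\<in>set fs. wt f"
  shows "cls (tsubst_redn (pad (FunR Unit []) fs) s) = cls (tsubst_redn (pad (FunR Unit []) fs) t)"
proof -
  let ?\<theta> = "pad (FunR Unit []) fs"
  note ty = wt_pad[OF assms(2)]
  have "redn_eq (Mon n) (Ident s) (Ident t) s s" using assms(1) by (rule re_ident)
  then have "redn_eq (Mon n) (subst_redn (\<lambda>x. redn_tgt (?\<theta> x)) ?\<theta> (Ident s)) (subst_redn (\<lambda>x. redn_tgt (?\<theta> x)) ?\<theta> (Ident t))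
      (tsubst (\<lambda>x. redn_src (?\<theta> x)) s) (tsubst (\<lambda>x. redn_tgt (?\<theta> x)) s)"
    by (rule re_subst) (intro allI re_refl ty)+
  from cls_eqI[OF this] show ?thesis by simp
qed

text \<open>Substituting \<open>f\<close>, \<open>g\<close>, \<open>h\<close>, \<open>k\<close> into
  the interchange at four variables gives the rule applied to them; \<open>re_nat1\<close> and
  \<open>re_nat2\<close> are its two factorisations.\<close>

lemma cls_rule_natural:
  assumes ij: "1 \<le> i" "i < j" "j \<le> n" and wt: "wt f" "wt g" "wt h" "wt k"
  shows "cls (RuleR (i, j) [f, g, h, k]) =
      cls (((f \<^bold>\<otimes>\<^bsub>j\<^esub> g) \<^bold>\<otimes>\<^bsub>i\<^esub> (h \<^bold>\<otimes>\<^bsub>j\<^esub> k)) \<cdot> eta i j (redn_tgt f) (redn_tgt g) (redn_tgt h) (redn_tgt k))"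
    and "cls (RuleR (i, j) [f, g, h, k]) =
      cls (eta i j (redn_src f) (redn_src g) (redn_src h) (redn_src k) \<cdot> ((f \<^bold>\<otimes>\<^bsub>i\<^esub> h) \<^bold>\<otimes>\<^bsub>j\<^esub> (g \<^bold>\<otimes>\<^bsub>i\<^esub> k)))"
proof -
  let ?\<theta> = "pad (FunR Unit []) [f, g, h, k]"
  have ij': "i \<in> {1..n}" "j \<in> {1..n}" using ij by auto
  have "\<forall>f\<in>set [f, g, h, k]. wt f" using wt by simp
  note pad = wt_pad[OF this]
  have ty: "\<forall>x. is_redn (Mon n) (?\<theta> x) (redn_src (?\<theta> x)) (redn_tgt (?\<theta> x))"
    "\<forall>x. redn_src (?\<theta> x) \<in> wf_terms (Mon n)" "\<forall>x. redn_tgt (?\<theta> x) \<in> wf_terms (Mon n)"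
    by (intro allI pad)+
  have eta: "is_redn (Mon n) (eta i j (Var 0) (Var 1) (Var 2) (Var 3))
      ((Var 0 \<otimes>\<^bsub>j\<^esub> Var 1) \<otimes>\<^bsub>i\<^esub> (Var 2 \<otimes>\<^bsub>j\<^esub> Var 3)) ((Var 0 \<otimes>\<^bsub>i\<^esub> Var 2) \<otimes>\<^bsub>j\<^esub> (Var 1 \<otimes>\<^bsub>i\<^esub> Var 3))"
    by (intro red_eta ij wf_Var)
  have wf: "(Var 0 \<otimes>\<^bsub>j\<^esub> Var 1) \<otimes>\<^bsub>i\<^esub> (Var 2 \<otimes>\<^bsub>j\<^esub> Var 3) \<in> wf_terms (Mon n)"
    "(Var 0 \<otimes>\<^bsub>i\<^esub> Var 2) \<otimes>\<^bsub>j\<^esub> (Var 1 \<otimes>\<^bsub>i\<^esub> Var 3) \<in> wf_terms (Mon n)"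
    by (intro wf_mon ij')+
  show "cls (RuleR (i, j) [f, g, h, k]) =
      cls (((f \<^bold>\<otimes>\<^bsub>j\<^esub> g) \<^bold>\<otimes>\<^bsub>i\<^esub> (h \<^bold>\<otimes>\<^bsub>j\<^esub> k)) \<cdot> eta i j (redn_tgt f) (redn_tgt g) (redn_tgt h) (redn_tgt k))"
    using cls_eqI[OF re_nat1[OF eta ty(1) wf(1) ty(2,3)]] by (simp add: numeral_eq_Suc)
  show "cls (RuleR (i, j) [f, g, h, k]) =
      cls (eta i j (redn_src f) (redn_src g) (redn_src h) (redn_src k) \<cdot> ((f \<^bold>\<otimes>\<^bsub>i\<^esub> h) \<^bold>\<otimes>\<^bsub>j\<^esub> (g \<^bold>\<otimes>\<^bsub>i\<^esub> k)))"
    using cls_eqI[OF re_nat2[OF eta ty(1) wf(2) ty(2,3)]] by (simp add: numeral_eq_Suc)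
qed

end

lemma unit_axioms: "\<lbrakk>1 \<le> i; i < j; j \<le> n\<rbrakk> \<Longrightarrow> unit_eqs i j \<subseteq> redn_eqs (Mon n)"
  and assoc_axioms: "\<lbrakk>1 \<le> i; i < j; j \<le> n\<rbrakk> \<Longrightarrow> assoc_eqs i j \<subseteq> redn_eqs (Mon n)"
  and hexagon_axioms: "\<lbrakk>1 \<le> i; i < j; j < k; k \<le> n\<rbrakk> \<Longrightarrow> hexagon_eqs i j k \<subseteq> redn_eqs (Mon n)"
  by (fastforce simp: Mon_def)+

context
  fixes n :: nat
begin

section \<open>The laws of a strict n-fold monoidal category for classes\<close>

lemma marr_cls: "wt n f \<Longrightarrow> marr n (cls n f)"
  by (auto simp: marr_def)

lemma mcompE:
  assumes "marr n M" "marr n N" "mtgt n M = msrc n N"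
  obtains f g where "wt n f" "wt n g" "M = cls n f" "N = cls n g"
    "term_eq (Mon n) (redn_tgt f) (redn_src g)"
proof -
  obtain f g where fg: "wt n f" "M = cls n f" "wt n g" "N = cls n g"
    using assms(1,2) by (auto elim!: marrE)
  then have "term_eq (Mon n) (redn_tgt f) (redn_src g)"
    using assms(3) wt_wf[OF fg(1)] wt_wf[OF fg(3)] by (simp add: msrc_cls mtgt_cls cls_Ident_eq_iff)
  from that[OF fg(1,3,2,4) this] show ?thesis .
qed

lemma mcomp_assoc:
  assumes "marr n L" "marr n M" "marr n N" "mtgt n L = msrc n M" "mtgt n M = msrc n N"
  shows "mcomp n (mcomp n L M) N = mcomp n L (mcomp n M N)"
proof -
  obtain f g where fg: "wt n f" "wt n g" "L = cls n f" "M = cls n g" "term_eq (Mon n) (redn_tgt f) (redn_src g)"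
    using mcompE[OF assms(1,2,4)] .
  obtain h where h: "wt n h" "N = cls n h"
    using assms(3) by (auto elim!: marrE)
  have gh: "term_eq (Mon n) (redn_tgt g) (redn_src h)"
    using assms(5) wt_wf[OF fg(2)] wt_wf[OF h(1)] fg h by (simp add: msrc_cls mtgt_cls cls_Ident_eq_iff)
  have "is_redn (Mon n) f (redn_src f) (redn_tgt f)" "is_redn (Mon n) g (redn_tgt f) (redn_tgt g)"
    "is_redn (Mon n) h (redn_tgt g) (redn_tgt h)"
    using comp_typed[OF fg(1,2,5)] comp_typed[OF fg(2) h(1) gh] fg(1) by (simp_all add: wt_def)
  from cls_eqI[OF re_assoc[OF this]] show ?thesis
    using fg h gh by (simp add: mcomp_cls wt_comp)
qed

lemma mcomp_in:
  assumes "marr n M" "marr n N" "mtgt n M = msrc n N"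
  shows "marr n (mcomp n M N)" "msrc n (mcomp n M N) = msrc n M" "mtgt n (mcomp n M N) = mtgt n N"
proof -
  obtain f g where fg: "wt n f" "wt n g" "M = cls n f" "N = cls n g" "term_eq (Mon n) (redn_tgt f) (redn_src g)"
    using mcompE[OF assms] .
  then show "marr n (mcomp n M N)" "msrc n (mcomp n M N) = msrc n M" "mtgt n (mcomp n M N) = mtgt n N"
    by (simp_all add: mcomp_cls marr_cls wt_comp msrc_cls mtgt_cls)
qed

lemma
  assumes "marr n M"
  shows mcomp_src: "mcomp n (msrc n M) M = M" and mcomp_tgt: "mcomp n M (mtgt n M) = M"
proof -
  obtain f where f: "wt n f" "M = cls n f" using assms by (auto elim!: marrE)
  then have ty: "is_redn (Mon n) f (redn_src f) (redn_tgt f)" by (simp add: wt_def)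
  show "mcomp n (msrc n M) M = M" "mcomp n M (mtgt n M) = M"
    using cls_eqI[OF re_id_left[OF ty]] cls_eqI[OF re_id_right[OF ty]] f wt_wf[OF f(1)]
    by (simp_all add: msrc_cls mtgt_cls mcomp_cls wt_Ident te_refl)
qed

lemma msrc_in:
  assumes "marr n M"
  shows "marr n (msrc n M)" "msrc n (msrc n M) = msrc n M" "mtgt n (msrc n M) = msrc n M"
    "marr n (mtgt n M)" "msrc n (mtgt n M) = mtgt n M" "mtgt n (mtgt n M) = mtgt n M"
proof -
  obtain f where f: "wt n f" "M = cls n f" using assms by (auto elim!: marrE)
  then show "marr n (msrc n M)" "msrc n (msrc n M) = msrc n M" "mtgt n (msrc n M) = msrc n M"
    "marr n (mtgt n M)" "msrc n (mtgt n M) = mtgt n M" "mtgt n (mtgt n M) = mtgt n M"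
    using wt_wf[OF f(1)] by (simp_all add: msrc_cls mtgt_cls wt_Ident marr_cls)
qed

lemma mten_in:
  assumes "i \<in> {1..n}" "marr n M" "marr n N"
  shows "marr n (mten n i M N)" "msrc n (mten n i M N) = mten n i (msrc n M) (msrc n N)"
    "mtgt n (mten n i M N) = mten n i (mtgt n M) (mtgt n N)"
proof -
  obtain f g where fg: "wt n f" "M = cls n f" "wt n g" "N = cls n g"
    using assms(2,3) by (auto elim!: marrE)
  then have "mten n i M N = cls n (f \<^bold>\<otimes>\<^bsub>i\<^esub> g)" "wt n (f \<^bold>\<otimes>\<^bsub>i\<^esub> g)"
    using assms(1) by (simp_all add: mten_cls wt_tensor)
  then show "marr n (mten n i M N)" "msrc n (mten n i M N) = mten n i (msrc n M) (msrc n N)"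
    "mtgt n (mten n i M N) = mten n i (mtgt n M) (mtgt n N)"
    using assms(1) fg wt_wf[OF fg(1)] wt_wf[OF fg(3)]
    by (simp_all add: marr_cls msrc_cls mtgt_cls mten_Ident)
qed

lemma mten_assoc:
  assumes "i \<in> {1..n}" "marr n L" "marr n M" "marr n N"
  shows "mten n i (mten n i L M) N = mten n i L (mten n i M N)"
proof -
  obtain f g h where fgh: "wt n f" "L = cls n f" "wt n g" "M = cls n g" "wt n h" "N = cls n h"
    using assms(2-4) by (auto elim!: marrE)
  have "\<forall>f\<in>set [f, g, h]. wt n f" using fgh by simp
  from cls_term_axiom[OF te_assoc[OF assms(1) wf_Var wf_Var wf_Var] this, of 0 1 2] show ?thesis
    using fgh assms(1) by (simp add: mten_cls wt_tensor numeral_eq_Suc)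
qed

lemma mten_unit:
  assumes "i \<in> {1..n}" "marr n M"
  shows "mten n i M (mU n) = M" "mten n i (mU n) M = M"
proof -
  obtain f where f: "wt n f" "M = cls n f"
    using assms(2) by (auto elim!: marrE)
  have wt: "\<forall>f\<in>set [f]. wt n f" using f by simp
  show "mten n i M (mU n) = M" "mten n i (mU n) M = M"
    using cls_term_axiom[OF te_unit_right[OF assms(1) wf_Var[of 0] wf_Var wf_Var] wt]
      cls_term_axiom[OF te_unit_left[OF assms(1) wf_Var[of 0] wf_Var wf_Var] wt] assms(1)
    by (simp_all add: f mU_cls mten_cls wt_unit)
qed

lemma mten_comp:
  assumes "i \<in> {1..n}" "marr n M" "marr n N" "marr n M'" "marr n N'"
    "mtgt n M = msrc n N" "mtgt n M' = msrc n N'"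
  shows "mten n i (mcomp n M N) (mcomp n M' N') = mcomp n (mten n i M M') (mten n i N N')"
proof -
  obtain f g where fg: "wt n f" "wt n g" "M = cls n f" "N = cls n g" "term_eq (Mon n) (redn_tgt f) (redn_src g)"
    using mcompE[OF assms(2,3,6)] .
  obtain f' g' where fg': "wt n f'" "wt n g'" "M' = cls n f'" "N' = cls n g'"
    "term_eq (Mon n) (redn_tgt f') (redn_src g')"
    using mcompE[OF assms(4,5,7)] .
  have "redn_eq (Mon n) (FunR (Tensor i) [f, f'] \<cdot> FunR (Tensor i) [g, g']) (FunR (Tensor i) (map2 (\<cdot>) [f, f'] [g, g']))
      (App (Tensor i) [redn_src f, redn_src f']) (App (Tensor i) [redn_tgt g, redn_tgt g'])"
    using assms(1) fg(1) fg'(1) comp_typed[OF fg(1,2,5)] comp_typed[OF fg'(1,2,5)]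
    by (intro re_fun_comp[where ts = "[redn_tgt f, redn_tgt f']"]) (simp_all add: wt_def all_less_2)
  from cls_eqI[OF this] show ?thesis
    using assms(1) fg fg' by (simp add: mten_cls mcomp_cls wt_tensor wt_comp te_tensor)
qed

text \<open>Naturality is split at the diagonal: both composites equal \<open>mic\<close> at the
  arrows. The first half also matches \<open>rule_op\<close>, the value of a rule under
  evaluation.\<close>

lemma mic_natural:
  assumes ij: "1 \<le> i" "i < j" "j \<le> n" and "marr n F" "marr n G" "marr n H" "marr n K"
  shows "mcomp n (mten n i (mten n j F G) (mten n j H K)) (mic n i j (mtgt n F) (mtgt n G) (mtgt n H) (mtgt n K)) =
      mic n i j F G H K" (is ?tgt)
    "mcomp n (mic n i j (msrc n F) (msrc n G) (msrc n H) (msrc n K)) (mten n j (mten n i F H) (mten n i G K)) =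
      mic n i j F G H K" (is ?src)
proof -
  obtain f g h k where wt: "wt n f" "wt n g" "wt n h" "wt n k"
    and cls: "F = cls n f" "G = cls n g" "H = cls n h" "K = cls n k"
    using assms(4-) by (auto elim!: marrE)
  note wf = wt[THEN wt_wf]
  have ij': "i \<in> {1..n}" "j \<in> {1..n}" using ij by auto
  show ?tgt ?src
    using cls_rule_natural[OF ij wt] ij ij' wf wt
    by (simp_all add: cls mten_cls mic_cls msrc_cls mtgt_cls mcomp_cls wt_tensor wt_rule wt_Ident
        numeral_eq_Suc te_refl wf_tensor)
qed

lemma mic_in:
  assumes ij: "1 \<le> i" "i < j" "j \<le> n" and "mide n A" "mide n B" "mide n C" "mide n D"
  shows "marr n (mic n i j A B C D)" "msrc n (mic n i j A B C D) = mten n i (mten n j A B) (mten n j C D)"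
    "mtgt n (mic n i j A B C D) = mten n j (mten n i A C) (mten n i B D)"
proof -
  obtain a b c d where wf: "a \<in> wf_terms (Mon n)" "b \<in> wf_terms (Mon n)" "c \<in> wf_terms (Mon n)" "d \<in> wf_terms (Mon n)"
    and cls: "A = cls n (Ident a)" "B = cls n (Ident b)" "C = cls n (Ident c)" "D = cls n (Ident d)"
    using assms(4-) by (auto elim!: mideE)
  have ij': "i \<in> {1..n}" "j \<in> {1..n}" using ij by auto
  have ic: "mic n i j A B C D = cls n (eta i j a b c d)" "wt n (eta i j a b c d)"
    using ij wf by (simp_all add: cls mic_cls wt_rule wt_Ident)
  show "marr n (mic n i j A B C D)" "msrc n (mic n i j A B C D) = mten n i (mten n j A B) (mten n j C D)"
    "mtgt n (mic n i j A B C D) = mten n j (mten n i A C) (mten n i B D)"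
    unfolding ic(1) using ic(2) ij' wf
    by (simp_all add: marr_cls msrc_cls mtgt_cls cls mten_Ident wf_tensor numeral_eq_Suc)
qed

lemma mic_unit:
  assumes ij: "1 \<le> i" "i < j" "j \<le> n" and "mide n A" "mide n B"
  shows "mic n i j A B (mU n) (mU n) = mten n j A B" "mic n i j (mU n) (mU n) A B = mten n j A B"
    "mic n i j A (mU n) B (mU n) = mten n i A B" "mic n i j (mU n) A (mU n) B = mten n i A B"
proof -
  obtain a b where wf: "a \<in> wf_terms (Mon n)" "b \<in> wf_terms (Mon n)"
    and cls: "A = cls n (Ident a)" "B = cls n (Ident b)"
    using assms(4-) by (auto elim!: mideE)
  have ij': "i \<in> {1..n}" "j \<in> {1..n}" using ij by auto
  have "\<forall>s\<in>set [a, b]. s \<in> wf_terms (Mon n)" using wf by simp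
  note ax = cls_inst_axiom[OF subsetD[OF unit_axioms[OF ij]] this, unfolded unit_eqs_def Let_def]
  show "mic n i j A B (mU n) (mU n) = mten n j A B" "mic n i j (mU n) (mU n) A B = mten n j A B"
    "mic n i j A (mU n) B (mU n) = mten n i A B" "mic n i j (mU n) A (mU n) B = mten n i A B"
    using ax[OF insertI1] ax[OF insertI2[OF insertI1]] ax[OF insertI2[OF insertI2[OF insertI1]]]
      ax[OF insertI2[OF insertI2[OF insertI2[OF insertI1]]]] ij ij' wf
    by (simp_all add: cls mU_cls mic_cls mten_cls wt_Ident wt_unit)
qed

lemma mic_assoc:
  assumes ij: "1 \<le> i" "i < j" "j \<le> n"
    and "mide n A" "mide n B" "mide n C" "mide n D" "mide n E" "mide n F"
  shows "mcomp n (mten n i (mic n i j A B C D) (mten n j E F)) (mic n i j (mten n i A C) (mten n i B D) E F) =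
      mcomp n (mten n i (mten n j A B) (mic n i j C D E F)) (mic n i j A B (mten n i C E) (mten n i D F))" (is ?internal)
    and "mcomp n (mic n i j (mten n j A B) C (mten n j D E) F) (mten n j (mic n i j A B D E) (mten n i C F)) =
      mcomp n (mic n i j A (mten n j B C) D (mten n j E F)) (mten n j (mten n i A D) (mic n i j B C E F))" (is ?external)
proof -
  obtain a b c d e f where wf: "a \<in> wf_terms (Mon n)" "b \<in> wf_terms (Mon n)" "c \<in> wf_terms (Mon n)"
      "d \<in> wf_terms (Mon n)" "e \<in> wf_terms (Mon n)" "f \<in> wf_terms (Mon n)"
    and cls: "A = cls n (Ident a)" "B = cls n (Ident b)" "C = cls n (Ident c)" "D = cls n (Ident d)"
      "E = cls n (Ident e)" "F = cls n (Ident f)"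
    using assms(4-) by (auto elim!: mideE)
  have ij': "i \<in> {1..n}" "j \<in> {1..n}" using ij by auto
  have "\<forall>s\<in>set [a, b, c, d, e, f]. s \<in> wf_terms (Mon n)" using wf by simp
  note ax = cls_inst_axiom[OF subsetD[OF assoc_axioms[OF ij]] this, unfolded assoc_eqs_def Let_def]
  show ?internal ?external
    using ax[OF insertI1] ax[OF insertI2[OF insertI1]] ij ij' wf
    by (simp_all add: cls mic_cls mten_cls mcomp_cls wt_Ident wt_tensor wt_rule te_refl wf_tensor numeral_eq_Suc)
qed

lemma mic_hexagon:
  assumes ijk: "1 \<le> i" "i < j" "j < k" "k \<le> n"
    and "mide n A" "mide n B" "mide n C" "mide n D" "mide n E" "mide n F" "mide n G" "mide n H"
  shows "mcomp n (mten n i (mic n j k A B C D) (mic n j k E F G H))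
      (mcomp n (mic n i k (mten n j A C) (mten n j B D) (mten n j E G) (mten n j F H))
        (mten n k (mic n i j A C E G) (mic n i j B D F H))) =
    mcomp n (mic n i j (mten n k A B) (mten n k C D) (mten n k E F) (mten n k G H))
      (mcomp n (mten n j (mic n i k A B E F) (mic n i k C D G H))
        (mic n j k (mten n i A E) (mten n i B F) (mten n i C G) (mten n i D H)))"
proof -
  obtain a where a: "a \<in> wf_terms (Mon n)" "A = cls n (Ident a)" using assms(5) by (rule mideE)
  obtain b where b: "b \<in> wf_terms (Mon n)" "B = cls n (Ident b)" using assms(6) by (rule mideE)
  obtain c where c: "c \<in> wf_terms (Mon n)" "C = cls n (Ident c)" using assms(7) by (rule mideE)
  obtain d where d: "d \<in> wf_terms (Mon n)" "D = cls n (Ident d)" using assms(8) by (rule mideE)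
  obtain e where e: "e \<in> wf_terms (Mon n)" "E = cls n (Ident e)" using assms(9) by (rule mideE)
  obtain f where f: "f \<in> wf_terms (Mon n)" "F = cls n (Ident f)" using assms(10) by (rule mideE)
  obtain g where g: "g \<in> wf_terms (Mon n)" "G = cls n (Ident g)" using assms(11) by (rule mideE)
  obtain h where h: "h \<in> wf_terms (Mon n)" "H = cls n (Ident h)" using assms(12) by (rule mideE)
  note wf = a(1) b(1) c(1) d(1) e(1) f(1) g(1) h(1) and cls = a(2) b(2) c(2) d(2) e(2) f(2) g(2) h(2)
  have ijk': "i \<in> {1..n}" "j \<in> {1..n}" "k \<in> {1..n}" "1 \<le> j" "j \<le> n" "i < k" using ijk by auto
  have "\<forall>s\<in>set [a, b, c, d, e, f, g, h]. s \<in> wf_terms (Mon n)" using wf by simp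
  note ax = cls_inst_axiom[OF subsetD[OF hexagon_axioms[OF ijk]] this, unfolded hexagon_eqs_def Let_def]
  show ?thesis
    using ax[OF insertI1] ijk ijk' wf
    by (simp add: cls mic_cls mten_cls mcomp_cls wt_Ident wt_tensor wt_rule wt_comp te_refl wf_tensor numeral_eq_Suc)
qed

lemma strict_nfold_monoidal_cls:
  "strict_nfold_monoidal n (marr n) (msrc n) (mtgt n) (mcomp n) (mten n) (mU n) (mic n) (mide n)"
proof
  show "mide n M \<longleftrightarrow> marr n M \<and> msrc n M = M" for M by (rule mide_def)
  show "marr n (mU n)" "msrc n (mU n) = mU n" "mtgt n (mU n) = mU n"
    by (simp_all add: mU_def marr_cls msrc_cls mtgt_cls wt_Ident wf_unit)
qed (fact msrc_in mcomp_in mcomp_assoc mcomp_src mcomp_tgt mten_in mten_assoc mten_comp mten_unit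
    mic_in mic_unit mic_assoc mic_hexagon | simp add: mic_natural)+

end

section \<open>Evaluation at the generic valuation in the category of classes\<close>

theorem theorem7p2p6:
  fixes n :: nat and a b :: mon_trm
  assumes "a \<in> wf_terms (Mon n)" and "b \<in> wf_terms (Mon n)"
    and "no_repeated_vars a" and "no_repeated_vars b"
  shows "\<exists>\<^sub>\<le>\<^sub>1 \<Phi>. \<Phi> \<in> reductions (Mon n) a b"
proof -
  interpret M: strict_nfold_monoidal n "marr n" "msrc n" "mtgt n" "mcomp n" "mten n" "mU n" "mic n" "mide n"
    by (rule strict_nfold_monoidal_cls)
  \<comment> \<open>Each variable is sent to its own identity, so that evaluation returns the class
    of a reduction and equal values mean congruent reductions.\<close>
  let ?v = "\<lambda>x. cls n (Ident (Var x))"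
  have v: "mide n (?v x)" for x
    by (simp add: mide_def marr_cls msrc_cls wt_Ident wf_Var)
  have tm: "M.tm ?v t = cls n (Ident t)" if "t \<in> wf_terms (Mon n)" for t
    using that by (induction rule: wf_Mon_induct) (simp_all add: mten_Ident mU_def[symmetric])
  have ev: "M.ev ?v f = cls n f" if "is_redn (Mon n) f s t" for f s t
    using that
  proof (induction rule: is_redn_Mon_induct)
    case unit
    show ?case by (simp add: mU_cls[symmetric])
  next
    case (tensor i f g s s' t t')
    then show ?case by (simp add: mten_cls wtI)
  next
    case (rule i j f g h k a b c d a' b' c' d')
    note wt = rule.hyps(4-7)[THEN wtI]
    then show ?case
      using mic_natural(1)[OF rule.hyps(1-3) wt[THEN marr_cls]] rule
      by (simp add: M.rule_op_def numeral_eq_Suc mic_cls)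
  next
    case (comp f g s t u)
    have "term_eq (Mon n) (redn_tgt f) (redn_src g)"
      using is_redn_src_tgt[OF comp.hyps(1)] is_redn_src_tgt[OF comp.hyps(2)] by (blast intro: te_trans te_sym)
    then show ?case
      using comp by (simp add: mcomp_cls wtI)
  qed (simp_all add: tm)
  have eq: "redn_eq (Mon n) f g a b" if f: "is_redn (Mon n) f a b" and g: "is_redn (Mon n) g a b" for f g
  proof -
    have "cls n f = cls n g"
      using M.ev_unique[OF v assms(1) _ f g] ev[OF f] ev[OF g] assms(3) by (simp add: no_repeated_vars_def)
    \<comment> \<open>Equality of classes gives congruence at the syntactic endpoints of
      \<open>f\<close>, which are then converted back to \<open>a\<close> and
      \<open>b\<close>.\<close>
    from cls_eqD[OF wtI[OF g] this] show ?thesis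
      using is_redn_src_tgt[OF f] by (blast intro: re_conv te_sym)
  qed
  let ?A = "{\<phi>. is_redn (Mon n) \<phi> a b}" and ?r = "{(\<phi>, \<psi>). redn_eq (Mon n) \<phi> \<psi> a b}"
  have equiv: "equiv ?A ?r"
    by (rule equiv_redn_eq[OF is_two_theory_Mon])
  have "\<Phi> = \<Psi>" if mem: "\<Phi> \<in> ?A // ?r" "\<Psi> \<in> ?A // ?r" for \<Phi> \<Psi>
  proof -
    obtain f where f: "f \<in> ?A" "\<Phi> = ?r `` {f}" using mem(1) by (rule quotientE)
    obtain g where g: "g \<in> ?A" "\<Psi> = ?r `` {g}" using mem(2) by (rule quotientE)
    show ?thesis
      using f g equiv_class_eq[OF equiv, of f g] eq by simp
  qed
  then show ?thesis
    unfolding Uniq_def reductions_def by blast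
qed

end
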